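(* Let $0<p\le\infty$ and let $v$ be a weight on $(0,\infty)$. A function $h$ belongs to $L^p(v)$ if and only if $h$ admits a factorization $h=f\cdot g$ such that $f\in D_p(v)$ and $g\in G_p(v)$. Moreover, $$\|h\|_{L^p(v)}=\inf\{\|f\|_{D_p(v)}\,\|g\|_{G_p(v)}\},$$ where the infimum is taken over all possible factorizations $h=f\cdot g$ with $f\in D_p(v)$ and $g\in G_p(v)$.
   Context: All functions are real-valued and Lebesgue measurable on $(0,\infty)$. A weight is a function $v$ that is positive a.e. and locally integrable on $(0,\infty)$, and $V(t)=\int_0^t v(s)\,ds$. For $0<p<\infty$, $\|h\|_{L^p(v)}=\left(\int_0^\infty |h(x)|^p v(x)\,dx\right)^{1/p}$ and $L^p(v)$ is the set of $h$ for which this is finite. For $0<p<\infty$, $G_p(v)$ is the set of functions $f$ with $$\|f\|_{G_p(v)}=\sup_{t>0}\left(\frac{1}{V(t)}\int_0^t|f(x)|^p v(x)\,dx\right)^{1/p}<\infty,$$ and $D_p(v)$ is the set of functions $f$ with $$\|f\|_{D_p(v)}=\left(\int_0^\infty \widehat f(x)^p\, v(x)\,dx\right)^{1/p}<\infty,\qquad \widehat f(x)=\operatorname{ess\,sup}_{t\ge x}|f(t)|.$$ (For $p<1$ the same notation is used although these quantities need not be norms.) For $p=\infty$, the spaces $L^\infty(v)$, $G_\infty(v)$ and $D_\infty(v)$ are all understood as $L^\infty(0,\infty)$ with the essential supremum norm.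
   Formalization: The weight v is assumed integrable on every interval (0,t), so that V(t) is finite; with integrability only on compact subsets of (0,∞) the claim fails for finite p, e.g. v(x)=1/x gives D_p(v)={0}. The identity h=fg is meant almost everywhere. *)

theory Defs
  imports "HOL-Analysis.Analysis" "HOL-Probability.Essential_Supremum"
begin

abbreviation half_line :: "real measure" where
  "half_line \<equiv> lebesgue_on {0<..}"

(* Power with a real exponent a > 0 on [0,\<infinity>]. *)
definition epowr :: "ennreal \<Rightarrow> real \<Rightarrow> ennreal" where
  "epowr y a = (if y = \<infinity> then \<infinity> else ennreal (enn2real y powr a))"

(* Local integrability is required up to the origin, i.e. on every interval (0,t), so that the
   primitive V(t) is a positive real number.  If v were only integrable on compact subsets of
   (0,\<infinity>), V could be identically infinite (v(x) = 1/x); then D_p(v) = {0} for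
   finite p, and the factorization theorem fails. *)
definition weight :: "(real \<Rightarrow> real) \<Rightarrow> bool" where
  "weight v \<longleftrightarrow>
     v \<in> borel_measurable half_line \<and>
     (AE x in half_line. 0 < v x) \<and>
     (\<forall>t>0. set_integrable lebesgue {0<..<t} v)"

definition primitive :: "(real \<Rightarrow> real) \<Rightarrow> real \<Rightarrow> ennreal" where
  "primitive v t = (\<integral>\<^sup>+x\<in>{0<..<t}. ennreal (v x) \<partial>lebesgue)"

definition Linf_norm :: "(real \<Rightarrow> real) \<Rightarrow> ennreal" where
  "Linf_norm h = esssup half_line (\<lambda>x. ennreal \<bar>h x\<bar>)"

(* The exponent p ranges over (0,\<infinity>]; all norms take the value \<infinity> exactly
   outside the corresponding space. *)
definition L_norm :: "ennreal \<Rightarrow> (real \<Rightarrow> real) \<Rightarrow> (real \<Rightarrow> real) \<Rightarrow> ennreal" where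
  "L_norm p v h =
     (if p = \<infinity> then Linf_norm h
      else epowr (\<integral>\<^sup>+x. epowr (ennreal \<bar>h x\<bar>) (enn2real p) * ennreal (v x) \<partial>half_line)
             (1 / enn2real p))"

definition G_norm :: "ennreal \<Rightarrow> (real \<Rightarrow> real) \<Rightarrow> (real \<Rightarrow> real) \<Rightarrow> ennreal" where
  "G_norm p v f =
     (if p = \<infinity> then Linf_norm f
      else (SUP t\<in>{0<..}.
              epowr ((\<integral>\<^sup>+x\<in>{0<..<t}. epowr (ennreal \<bar>f x\<bar>) (enn2real p) * ennreal (v x) \<partial>lebesgue)
                       / primitive v t)
                (1 / enn2real p)))"

definition decreasing_majorant :: "(real \<Rightarrow> real) \<Rightarrow> real \<Rightarrow> ennreal" where
  "decreasing_majorant f x = esssup (lebesgue_on {x..}) (\<lambda>t. ennreal \<bar>f t\<bar>)"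

definition D_norm :: "ennreal \<Rightarrow> (real \<Rightarrow> real) \<Rightarrow> (real \<Rightarrow> real) \<Rightarrow> ennreal" where
  "D_norm p v f =
     (if p = \<infinity> then Linf_norm f
      else epowr (\<integral>\<^sup>+x. epowr (decreasing_majorant f x) (enn2real p) * ennreal (v x) \<partial>half_line)
             (1 / enn2real p))"

definition L_space :: "ennreal \<Rightarrow> (real \<Rightarrow> real) \<Rightarrow> (real \<Rightarrow> real) set" where
  "L_space p v = {h \<in> borel_measurable half_line. L_norm p v h < \<infinity>}"

definition G_space :: "ennreal \<Rightarrow> (real \<Rightarrow> real) \<Rightarrow> (real \<Rightarrow> real) set" where
  "G_space p v = {f \<in> borel_measurable half_line. G_norm p v f < \<infinity>}"

definition D_space :: "ennreal \<Rightarrow> (real \<Rightarrow> real) \<Rightarrow> (real \<Rightarrow> real) set" where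
  "D_space p v = {f \<in> borel_measurable half_line. D_norm p v f < \<infinity>}"

(* As usual for such function spaces, the equality h = f g is meant almost everywhere. *)
definition factorizations ::
  "ennreal \<Rightarrow> (real \<Rightarrow> real) \<Rightarrow> (real \<Rightarrow> real) \<Rightarrow> ((real \<Rightarrow> real) \<times> (real \<Rightarrow> real)) set" where
  "factorizations p v h =
     {(f, g). f \<in> D_space p v \<and> g \<in> G_space p v \<and> (AE x in half_line. h x = f x * g x)}"

end

theory Submission
  imports Defs
begin

text \<open>
  For $p = \<infinity>$ all three norms are the essential supremum and $h = h \<cdot> 1$ is an optimal
  factorization. For finite $p$ raise everything to the power $p$: with the measures
  $dM = |h|^p v\,dx$ and $dN = v\,dx$ on the half-line, the norm of $h$ is a power of the total mass of
  $M$, and the theorem becomes a statement about comparing $M$ and $N$.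

  One inequality is Hardy's lemma (\<open>nn_integral_antimono_le\<close>): if a measure has at most
  $C$ times the mass of $N$ on every interval $(0,t)$, then the same comparison holds for integrals of
  decreasing functions. It is applied to the measure $|g|^p v\,dx$ and to the decreasing majorant of
  $|f|^p$, which dominates $|f|^p$ almost everywhere.

  For the other inequality one needs a decreasing $F$ with $\<integral>F\,dN$ close to the mass of $M$ and
  $\<integral>_0^t F^{-1}\,dM \<le> N(0,t)$ for all $t$; then $f = F^{1/p}$ and $g = h/f$ factorize $h$. The exact
  solution is the level function, the derivative of the least concave majorant of $U(t) = M(0,t)$ with
  respect to $V(t) = N(0,t)$. Since only an infimum is to be computed, it is enough to know its
  superlevel sets at the heights $r^k$, where $k$ is an integer and $r > 1$ is close to $1$. These sets
  can be described without the majorant: the one at height $l$ ends at the last maximum point $T$ of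
  $U - lV$. Maximality of $T$ gives both properties of $F$. To the right of $T$ it says that $M$ is
  dominated by $lN$ on intervals starting at $T$ (\<open>emeasure_outside_level_set_le\<close>), which
  yields the bound for $F^{-1}$. And when the slope decreases from $l$ to $l'$, the maximum grows by at
  least $(l - l')V(T)$ (\<open>emeasure_level_set_le\<close>); since the maximum stays between $0$ and the
  mass of $M$, these increments sum to at most that mass, which yields the bound for
  $\<integral>F\,dN$ up to the factor $r$.
\<close>

section \<open>Geometric staircases\<close>

lemma ennreal_le_if_le_mult_all:
  fixes X Y :: ennreal
  assumes "\<And>r::real. 1 < r \<Longrightarrow> X \<le> ennreal r * Y"
  shows "X \<le> Y"
proof (cases "Y = \<infinity>")
  case False
  have "((\<lambda>r. ennreal r * Y) \<longlongrightarrow> ennreal 1 * Y) (at_right 1)"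
    by (intro tendsto_mult_ennreal tendsto_ennrealI tendsto_intros) (use False in auto)
  moreover have "\<forall>\<^sub>F r in at_right 1. X \<le> ennreal r * Y"
    using assms by (auto simp: eventually_at_right_field intro: exI[of _ 2])
  ultimately show ?thesis
    using tendsto_lowerbound[of "\<lambda>r. ennreal r * Y" "ennreal 1 * Y" "at_right 1" X] by simp
qed simp

text \<open>For sets $S_k$ that decrease in $k$, the staircase takes the value $r^{K+1}$ at a point whose last
  set is $S_K$. Writing it as a sum over all integers, with increments that telescope, lets its
  integral be read off from the measures of the $S_k$.\<close>

definition staircase :: "real \<Rightarrow> (int \<Rightarrow> real set) \<Rightarrow> real \<Rightarrow> ennreal" where
  "staircase r S x =
     (\<integral>\<^sup>+k. ennreal (r powi (k + 1) - r powi k) * indicator (S k) x \<partial>count_space UNIV)"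

lemma nn_integral_telescoping_powi:
  fixes r :: real
  assumes r: "1 < r"
  shows "(\<integral>\<^sup>+k. ennreal (r powi (k + 1) - r powi k) * indicator {..K} k \<partial>count_space UNIV)
           = ennreal (r powi (K + 1))"
proof -
  have bij: "bij_betw (\<lambda>n. K - int n) UNIV {..K}"
    by (rule bij_betw_byWitness[where f' = "\<lambda>k. nat (K - k)"]) auto
  have "(\<lambda>n. r powi (K + 1) * inverse r ^ n) \<longlonglongrightarrow> r powi (K + 1) * 0"
    using r by (intro tendsto_intros LIMSEQ_realpow_zero) (auto simp: inverse_less_1_iff)
  moreover have powi_shift: "r powi (K - int n + 1) = r powi (K + 1) * inverse r ^ n" for n
    using r by (simp add: power_int_diff power_int_add field_simps)
  ultimately have "(\<lambda>n. r powi (K - int n + 1)) \<longlonglongrightarrow> 0"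
    by simp
  then have "(\<lambda>n. r powi (K - int n + 1) - r powi (K - int (Suc n) + 1)) sums (r powi (K - int 0 + 1) - 0)"
    by (rule telescope_sums')
  then have sums: "(\<lambda>n. r powi (K - int n + 1) - r powi (K - int n)) sums (r powi (K + 1))"
    by (simp add: algebra_simps)
  have "(\<integral>\<^sup>+k. ennreal (r powi (k + 1) - r powi k) * indicator {..K} k \<partial>count_space UNIV)
      = (\<integral>\<^sup>+k. ennreal (r powi (k + 1) - r powi k) \<partial>count_space {..K})"
    by (simp add: nn_integral_count_space_indicator)
  also have "\<dots> = (\<Sum>n. ennreal (r powi (K - int n + 1) - r powi (K - int n)))"
    by (simp add: nn_integral_bij_count_space[OF bij, symmetric] nn_integral_count_space_nat)
  also have "\<dots> = ennreal (r powi (K + 1))"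
    using r sums by (intro suminf_ennreal_eq) (auto intro!: power_int_increasing)
  finally show ?thesis .
qed

lemma staircase_eq_if_initial:
  assumes "1 < r" and "\<And>k. x \<in> S k \<longleftrightarrow> k \<le> K"
  shows "staircase r S x = ennreal (r powi (K + 1))"
  unfolding staircase_def nn_integral_telescoping_powi[OF assms(1), symmetric]
  using assms(2) by (intro nn_integral_cong) (auto simp: indicator_def)

lemma staircase_mono: "(\<And>k. x \<in> S k \<Longrightarrow> y \<in> T k) \<Longrightarrow> staircase r S x \<le> staircase r T y"
  unfolding staircase_def by (intro nn_integral_mono) (auto simp: indicator_def)

lemma staircase_eq_0: "(\<And>k. x \<notin> S k) \<Longrightarrow> staircase r S x = 0"
  unfolding staircase_def by simp

lemma nn_integral_staircase:
  assumes "\<And>k. S k \<in> sets M"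
  shows "(\<integral>\<^sup>+x. staircase r S x \<partial>M)
           = (\<integral>\<^sup>+k. ennreal (r powi (k + 1) - r powi k) * emeasure M (S k) \<partial>count_space UNIV)"
proof -
  have [measurable]: "S k \<in> sets M" for k by fact
  show ?thesis
    unfolding staircase_def
    by (subst nn_integral_count_space_nn_integral) (auto simp: nn_integral_cmult)
qed

lemma powi_bracket:
  fixes r y :: real
  assumes "1 < r" "0 < y"
  obtains K :: int where "r powi K < y" "y \<le> r powi (K + 1)"
proof -
  define K where "K = \<lceil>log r y\<rceil> - 1"
  have "real_of_int K < log r y" "log r y \<le> real_of_int (K + 1)"
    unfolding K_def by linarith+
  then have "r powr real_of_int K < y" "y \<le> r powr real_of_int (K + 1)"
    using assms by (simp_all add: less_log_iff log_le_iff)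
  then show ?thesis
    using assms powr_real_of_int'[of r K] powr_real_of_int'[of r "K + 1"]
    by (intro that[of K]) simp_all
qed

text \<open>Rounding the values of a function up to powers of $r$ changes them by at most the factor $r$. This
  is a discrete layer cake formula: since only a countable sum is exchanged with the integral, it
  applies to every measure.\<close>

lemma staircase_superlevel_bounds:
  fixes \<phi> :: "real \<Rightarrow> ennreal" and A :: "real set"
  assumes r: "1 < r"
  defines "S \<equiv> \<lambda>k. {x\<in>A. ennreal (r powi k) < \<phi> x}"
  assumes x: "x \<in> A"
  shows "\<phi> x \<le> staircase r S x" and "staircase r S x \<le> ennreal r * \<phi> x"
proof -
  consider "\<phi> x = 0" | "\<phi> x = \<infinity>" | y where "0 < y" "\<phi> x = ennreal y"
    by (cases "\<phi> x") (auto simp: less_le)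
  then have "\<phi> x \<le> staircase r S x \<and> staircase r S x \<le> ennreal r * \<phi> x"
  proof cases
    case 1
    then show ?thesis by (simp add: staircase_eq_0 S_def)
  next
    case 2
    have "ennreal (real n) \<le> staircase r S x" for n
    proof -
      obtain K :: int where "real n + 1 \<le> r powi (K + 1)"
        using powi_bracket[OF r, of "real n + 1"] by auto
      then have "ennreal (real n) \<le> ennreal (r powi (K + 1))"
        by (intro ennreal_leI) simp
      also have "\<dots> = staircase r (\<lambda>k. if k \<le> K then {x} else {}) x"
        using r by (intro staircase_eq_if_initial[symmetric]) auto
      also have "\<dots> \<le> staircase r S x"
        using 2 x by (intro staircase_mono) (auto simp: S_def less_top split: if_splits)
      finally show ?thesis .
    qed
    then have "staircase r S x = \<infinity>"
      by (metis ennreal_of_nat_eq_real_of_nat ennreal_Ex_less_of_nat infinity_ennreal_def less_le_not_le top.not_eq_extremum)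
    then show ?thesis using 2 r by (simp add: ennreal_mult_top)
  next
    case 3
    obtain K :: int where K: "r powi K < y" "y \<le> r powi (K + 1)"
      using powi_bracket[OF r \<open>0 < y\<close>] .
    have "x \<in> S k \<longleftrightarrow> k \<le> K" for k
    proof -
      have "k \<le> K \<Longrightarrow> r powi k < y"
        using power_int_increasing[of k K r] K r by force
      moreover have "\<not> k \<le> K \<Longrightarrow> y \<le> r powi k"
        using power_int_increasing[of "K + 1" k r] K r by force
      ultimately show ?thesis
        using r x by (cases "k \<le> K") (auto simp: S_def 3 ennreal_less_iff)
    qed
    then have "staircase r S x = ennreal (r powi (K + 1))"
      using r by (intro staircase_eq_if_initial)
    moreover have "r powi (K + 1) \<le> r * y"
      using K r by (simp add: power_int_add mult.commute)
    moreover have "ennreal r * ennreal y = ennreal (r * y)"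
      using r \<open>0 < y\<close> by (simp add: ennreal_mult)
    ultimately show ?thesis
      using K by (simp add: 3 ennreal_leI)
  qed
  then show "\<phi> x \<le> staircase r S x" "staircase r S x \<le> ennreal r * \<phi> x"
    by auto
qed

text \<open>The staircases of $\<phi>$ reduce the comparison of integrals to superlevel sets at the cost of a
  factor $r$, and $r > 1$ is arbitrary.\<close>

lemma nn_integral_le_if_superlevel_le:
  fixes \<phi> :: "real \<Rightarrow> ennreal"
  assumes sets: "sets M = sets N" and meas[measurable]: "\<phi> \<in> borel_measurable N"
    and le: "\<And>s. emeasure M {x\<in>space N. s < \<phi> x} \<le> C * emeasure N {x\<in>space N. s < \<phi> x}"
  shows "(\<integral>\<^sup>+x. \<phi> x \<partial>M) \<le> C * (\<integral>\<^sup>+x. \<phi> x \<partial>N)"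
proof (rule ennreal_le_if_le_mult_all)
  fix r :: real assume r: "1 < r"
  define S where "S = (\<lambda>k::int. {x\<in>space N. ennreal (r powi k) < \<phi> x})"
  have S: "S k \<in> sets N" for k
    unfolding S_def by measurable
  note bounds = staircase_superlevel_bounds[OF r, where A = "space N" and \<phi> = \<phi>, folded S_def]
  have "(\<integral>\<^sup>+x. \<phi> x \<partial>M) \<le> (\<integral>\<^sup>+x. staircase r S x \<partial>M)"
    using bounds by (intro nn_integral_mono) (simp add: sets_eq_imp_space_eq[OF sets])
  also have "\<dots> = (\<integral>\<^sup>+k. ennreal (r powi (k + 1) - r powi k) * emeasure M (S k) \<partial>count_space UNIV)"
    using S sets by (intro nn_integral_staircase) auto
  also have "\<dots> \<le> (\<integral>\<^sup>+k. C * (ennreal (r powi (k + 1) - r powi k) * emeasure N (S k)) \<partial>count_space UNIV)"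
  proof (intro nn_integral_mono)
    fix k
    show "ennreal (r powi (k + 1) - r powi k) * emeasure M (S k)
        \<le> C * (ennreal (r powi (k + 1) - r powi k) * emeasure N (S k))"
      using mult_left_mono[OF le[of "ennreal (r powi k)"], of "ennreal (r powi (k + 1) - r powi k)"]
      by (simp add: S_def mult.left_commute)
  qed
  also have "\<dots> = C * (\<integral>\<^sup>+x. staircase r S x \<partial>N)"
    using S by (simp add: nn_integral_cmult nn_integral_staircase)
  also have "\<dots> \<le> C * (\<integral>\<^sup>+x. ennreal r * \<phi> x \<partial>N)"
    using bounds by (intro mult_left_mono nn_integral_mono) auto
  also have "\<dots> = ennreal r * (C * (\<integral>\<^sup>+x. \<phi> x \<partial>N))"
    by (simp add: nn_integral_cmult mult.left_commute)
  finally show "(\<integral>\<^sup>+x. \<phi> x \<partial>M) \<le> ennreal r * (C * (\<integral>\<^sup>+x. \<phi> x \<partial>N))" .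
qed

section \<open>Initial segments of the half-line\<close>

definition initial_segment :: "real set \<Rightarrow> bool" where
  "initial_segment D \<longleftrightarrow> D \<subseteq> {0<..} \<and> (\<forall>x\<in>D. {0<..x} \<subseteq> D)"

lemma initial_segment_cases:
  assumes "initial_segment D"
  obtains "D = {0<..}" | s where "0 \<le> s" "D = {0<..<s}" | s where "0 \<le> s" "D = {0<..s}"
proof -
  have D: "D \<subseteq> {0<..}" "\<And>x y. x \<in> D \<Longrightarrow> 0 < y \<Longrightarrow> y \<le> x \<Longrightarrow> y \<in> D"
    using assms unfolding initial_segment_def by fastforce+
  consider "D = {}" | "D \<noteq> {}" "bdd_above D" | "\<not> bdd_above D"
    by (cases "D = {}"; cases "bdd_above D")
  then show thesis
  proof cases
    case 1
    then show thesis using that(2)[of 0] by simp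
  next
    case 2
    define s where "s = Sup D"
    have upper: "x \<le> s" if "x \<in> D" for x
      unfolding s_def using that 2 by (intro cSup_upper)
    have lower: "x \<in> D" if "0 < x" "x < s" for x
      using that 2 D(2) by (auto simp: s_def less_cSup_iff)
    have "0 \<le> s" using upper D(1) \<open>D \<noteq> {}\<close> by force
    show thesis
    proof (cases "s \<in> D")
      case True
      then have "D = {0<..s}" using D upper by auto
      then show thesis using that(3) \<open>0 \<le> s\<close> by blast
    next
      case False
      then have "D = {0<..<s}" using D(1) upper lower by (auto simp: less_le)
      then show thesis using that(2) \<open>0 \<le> s\<close> by blast
    qed
  next
    case 3
    have "x \<in> D" if "0 < x" for x
      using 3 D(2) that by (meson bdd_above.I2 bdd_above_def linear)
    then have "D = {0<..}" using D(1) by auto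
    then show thesis using that(1) by blast
  qed
qed

lemma initial_segment_Int: "initial_segment D \<Longrightarrow> initial_segment E \<Longrightarrow> initial_segment (D \<inter> E)"
  unfolding initial_segment_def by blast

lemma sets_half_line_borel: "A \<subseteq> {0<..} \<Longrightarrow> A \<in> sets borel \<Longrightarrow> A \<in> sets half_line"
  by (subst sets_restrict_space_iff) auto

lemma initial_segment_sets: "initial_segment D \<Longrightarrow> D \<in> sets half_line"
  by (elim initial_segment_cases) (auto intro: sets_half_line_borel)

lemma initial_segment_superlevel:
  fixes \<phi> :: "real \<Rightarrow> 'a::linorder"
  assumes "\<And>x y. 0 < x \<Longrightarrow> x \<le> y \<Longrightarrow> \<phi> y \<le> \<phi> x"
  shows "initial_segment {x\<in>{0<..}. s < \<phi> x}"
  unfolding initial_segment_def using assms by (fastforce intro: less_le_trans)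

lemma antimono_on_half_line_measurable:
  fixes \<phi> :: "real \<Rightarrow> 'a::{second_countable_topology, linorder_topology}"
  assumes "\<And>x y. 0 < x \<Longrightarrow> x \<le> y \<Longrightarrow> \<phi> y \<le> \<phi> x"
  shows "\<phi> \<in> borel_measurable half_line"
proof (rule borel_measurableI_greater)
  fix s
  show "{x \<in> space half_line. s < \<phi> x} \<in> sets half_line"
    using initial_segment_sets[OF initial_segment_superlevel[OF assms]]
    by (simp add: space_restrict_space)
qed

text \<open>The two kinds of measure that occur are $v\,dx$ and $|h|^p v\,dx$. Atomlessness makes the primitive
  $t \<mapsto> M(0,t)$ continuous and lets end points of intervals be added or dropped freely.\<close>

locale half_line_measure =
  fixes M :: "real measure"
  assumes sets_eq [measurable_cong]: "sets M = sets half_line"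
    and emeasure_singleton: "emeasure M {x} = 0"
    and emeasure_initial_finite: "emeasure M {0<..<t} < \<infinity>"
begin

lemma space_eq: "space M = {0<..}"
  using sets_eq_imp_space_eq[OF sets_eq] by (simp add: space_restrict_space)

lemma sets_borel: "A \<subseteq> {0<..} \<Longrightarrow> A \<in> sets borel \<Longrightarrow> A \<in> sets M"
  unfolding sets_eq by (rule sets_half_line_borel)

lemma interval_sets [simp, intro]: "0 \<le> s \<Longrightarrow> {s<..<t} \<in> sets M" "0 \<le> s \<Longrightarrow> {s<..t} \<in> sets M"
  by (auto intro!: sets_borel)

lemma initial_sets: "initial_segment D \<Longrightarrow> D \<in> sets M"
  unfolding sets_eq by (rule initial_segment_sets)

lemma emeasure_insert_point: "A \<in> sets M \<Longrightarrow> 0 < s \<Longrightarrow> emeasure M (insert s A) = emeasure M A"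
  using emeasure_Un_null_set[of A M "{s}"] sets_borel[of "{s}"]
  by (simp add: null_sets_def emeasure_singleton)

lemma emeasure_closed_initial: "emeasure M {0<..s} = emeasure M {0<..<s}"
proof (cases "0 < s")
  case True
  then have "{0<..s} = insert s {0<..<s}" by auto
  then show ?thesis using True by (simp add: emeasure_insert_point)
qed simp

lemma emeasure_half_line: "emeasure M {0<..} = (SUP n. emeasure M {0<..<real n})"
proof -
  have "{0<..} = (\<Union>n. {0<..<real n})"
    using reals_Archimedean2 by auto
  moreover have "incseq (\<lambda>n. {0<..<real n})"
    by (auto simp: incseq_def)
  ultimately show ?thesis
    using SUP_emeasure_incseq[of "\<lambda>n. {0<..<real n}" M] by (simp add: image_subset_iff)
qed

lemma measure_initial: "emeasure M {0<..<t} = ennreal (measure M {0<..<t})"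
  using emeasure_initial_finite[of t] by (intro emeasure_eq_ennreal_measure) auto

lemma measure_initial_mono: "s \<le> t \<Longrightarrow> measure M {0<..<s} \<le> measure M {0<..<t}"
  using emeasure_initial_finite[of t] by (intro measure_mono_fmeasurable fmeasurableI) (auto intro: sets_borel)

lemma emeasure_interval:
  assumes "0 \<le> s" "s \<le> t"
  shows "emeasure M {s<..<t} = ennreal (measure M {0<..<t} - measure M {0<..<s})"
proof (cases "s < t")
  case True
  have "{s<..<t} = {0<..<t} - {0<..s}" using assms by auto
  moreover have "emeasure M ({0<..<t} - {0<..s}) = emeasure M {0<..<t} - emeasure M {0<..s}"
    using True emeasure_initial_finite[of s]
    by (intro emeasure_Diff) (auto simp: emeasure_closed_initial intro: sets_borel)
  ultimately show ?thesis
    by (simp add: emeasure_closed_initial measure_initial ennreal_minus)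
qed (use assms in simp)

lemma continuous_on_measure_initial: "continuous_on UNIV (\<lambda>t. measure M {0<..<t})"
proof (rule continuous_on_sequentiallyI)
  fix u :: "nat \<Rightarrow> real" and a :: real
  assume u: "u \<longlonglongrightarrow> a"
  then obtain B where B: "\<And>n. norm (u n) \<le> B"
    using convergent_imp_Bseq[of u] by (auto simp: convergent_def Bseq_def)
  \<comment> \<open>dominated convergence of the indicator functions; they may fail to converge only at a\<close>
  have as_integral: "measure M {0<..<t} = (\<integral>x. indicator {0<..<t} x \<partial>M)" for t
    using emeasure_initial_finite[of t] by (simp add: sets_borel space_eq Int_absorb2 subset_eq)
  show "(\<lambda>n. measure M {0<..<u n}) \<longlonglongrightarrow> measure M {0<..<a}"
    unfolding as_integral
  proof (rule integral_dominated_convergence[where w = "indicator {0<..<B + 1}"])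
    show "integrable M (indicator {0<..<B + 1} :: real \<Rightarrow> real)"
      using emeasure_initial_finite[of "B + 1"] by (intro integrable_real_indicator) (auto intro: sets_borel)
    have "AE x in M. x \<noteq> a"
      using emeasure_singleton[of a] by (intro AE_I[of _ _ "{a} \<inter> {0<..}"])
        (auto simp: space_eq Int_insert_left intro: sets_borel)
    then show "AE x in M. (\<lambda>n. indicator {0<..<u n} x :: real) \<longlonglongrightarrow> indicator {0<..<a} x"
    proof eventually_elim
      case (elim x)
      have "\<forall>\<^sub>F n in sequentially. (x < u n) = (x < a)"
      proof (cases "x < a")
        case True
        then show ?thesis using order_tendstoD(1)[OF u, of x] by simp
      next
        case False
        then show ?thesis using order_tendstoD(2)[OF u, of x] elim
          by (auto elim!: eventually_mono)
      qed
      then have "\<forall>\<^sub>F n in sequentially. indicator {0<..<u n} x = (indicator {0<..<a} x :: real)"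
        by eventually_elim (auto simp: indicator_def)
      then show ?case
        by (rule tendsto_eventually)
    qed
    show "AE x in M. norm (indicator {0<..<u n} x :: real) \<le> indicator {0<..<B + 1} x" for n
      using B[of n] by (auto simp: indicator_def)
  qed (auto intro!: borel_measurable_indicator sets_borel)
qed

end

section \<open>Integrals of decreasing functions\<close>

text \<open>An inequality between the masses of the intervals $(0,t)$ extends to all initial segments, hence to
  the superlevel sets of any decreasing function.\<close>

lemma emeasure_initial_segment_le:
  assumes "half_line_measure M" "sets N = sets half_line"
    and le: "\<And>t. emeasure M {0<..<t} \<le> C * emeasure N {0<..<t}"
    and D: "initial_segment D"
  shows "emeasure M D \<le> C * emeasure N D"
proof -
  interpret half_line_measure M by fact
  have N_mono: "emeasure M {0<..<t} \<le> C * emeasure N D" if "{0<..<t} \<subseteq> D" for t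
    using le[of t] mult_left_mono[OF emeasure_mono[of "{0<..<t}" D N], of C]
      that initial_segment_sets[OF D] assms(2) by (auto intro: order_trans)
  show ?thesis
    using D
  proof (cases rule: initial_segment_cases)
    case 1
    have "emeasure M D = (SUP n. emeasure M {0<..<real n})"
      using 1 emeasure_half_line by simp
    also have "\<dots> \<le> C * emeasure N D"
      using 1 by (intro SUP_least N_mono) auto
    finally show ?thesis .
  next
    case (2 s)
    then show ?thesis using le by simp
  next
    case (3 s)
    then show ?thesis using N_mono[of s] by (auto simp: emeasure_closed_initial subset_eq)
  qed
qed

text \<open>Hardy's lemma: the superlevel sets of a decreasing function are initial segments.\<close>

lemma nn_integral_antimono_le:
  fixes \<phi> :: "real \<Rightarrow> ennreal"
  assumes "half_line_measure M" "sets N = sets half_line"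
    and "\<And>t. emeasure M {0<..<t} \<le> C * emeasure N {0<..<t}"
    and \<phi>: "\<And>x y. 0 < x \<Longrightarrow> x \<le> y \<Longrightarrow> \<phi> y \<le> \<phi> x"
  shows "(\<integral>\<^sup>+x. \<phi> x \<partial>M) \<le> C * (\<integral>\<^sup>+x. \<phi> x \<partial>N)"
proof (rule nn_integral_le_if_superlevel_le)
  interpret half_line_measure M by fact
  show "sets M = sets N" using sets_eq assms(2) by simp
  show "\<phi> \<in> borel_measurable N"
    using antimono_on_half_line_measurable[of \<phi>] \<phi> measurable_cong_sets[OF assms(2) refl] by auto
  have "space N = {0<..}"
    using sets_eq_imp_space_eq[OF assms(2)] by (simp add: space_restrict_space)
  then show "emeasure M {x \<in> space N. s < \<phi> x} \<le> C * emeasure N {x \<in> space N. s < \<phi> x}" for s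
    using emeasure_initial_segment_le[OF assms(1-3) initial_segment_superlevel[OF \<phi>]] by simp
qed

section \<open>Level functions\<close>

text \<open>Finite symmetric blocks telescope, and the integers are the increasing union of such blocks.\<close>

lemma nn_integral_telescoping_int_le:
  fixes a :: "int \<Rightarrow> real"
  assumes mono: "\<And>k. a k \<le> a (k - 1)" and bounds: "\<And>k. 0 \<le> a k" "\<And>k. a k \<le> B"
  shows "(\<integral>\<^sup>+k. ennreal (a (k - 1) - a k) \<partial>count_space UNIV) \<le> ennreal B"
proof -
  let ?M = "density (count_space UNIV) (\<lambda>k. ennreal (a (k - 1) - a k))"
  have telescope: "(\<Sum>k\<in>{- int n..int n}. a (k - 1) - a k) = a (- int n - 1) - a (int n)" for n
  proof (induction n)
    case (Suc n)
    have "{- int (Suc n)..int (Suc n)} = insert (- int n - 1) (insert (int n + 1) {- int n..int n})"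
      by auto
    then show ?case using Suc by (simp add: algebra_simps)
  qed simp
  have UNIV_eq: "(UNIV :: int set) = (\<Union>n. {- int n..int n})"
  proof (intro set_eqI iffI UNIV_I)
    fix x :: int
    show "x \<in> (\<Union>n. {- int n..int n})"
      by (rule UN_I[of "nat \<bar>x\<bar>"]) auto
  qed
  have "(\<integral>\<^sup>+k. ennreal (a (k - 1) - a k) \<partial>count_space UNIV) = emeasure ?M UNIV"
    by (simp add: emeasure_density)
  also have "\<dots> = (SUP n. emeasure ?M {- int n..int n})"
    unfolding UNIV_eq by (rule SUP_emeasure_incseq[symmetric]) (auto simp: incseq_def)
  also have "\<dots> \<le> ennreal B"
  proof (rule SUP_least)
    fix n
    have "emeasure ?M {- int n..int n} = (\<Sum>k\<in>{- int n..int n}. ennreal (a (k - 1) - a k))"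
      by (simp add: emeasure_density nn_integral_count_space_finite flip: nn_integral_count_space_indicator)
    also have "\<dots> = ennreal (a (- int n - 1) - a (int n))"
      using mono by (simp add: sum_ennreal telescope)
    also have "\<dots> \<le> ennreal B"
      using bounds(1)[of "int n"] bounds(2)[of "- int n - 1"] by (intro ennreal_leI) simp
    finally show "emeasure ?M {- int n..int n} \<le> ennreal B" .
  qed
  finally show ?thesis .
qed

text \<open>The level function of $M$ with respect to $N$ is the derivative of the least
  concave majorant of $U$ as a function of $V$. The superlevel set of that derivative at height $l$
  ends where the line of slope $l$ touches the majorant from above, that is, at the last maximum
  point of $U - lV$. This description by maximum points is taken as the definition below, and the
  majorant itself never appears.\<close>

locale level_function = M: half_line_measure M + N: half_line_measure N for M N +
  assumes M_finite: "emeasure M {0<..} < \<infinity>"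
    and N_pos: "0 < t \<Longrightarrow> 0 < emeasure N {0<..<t}"
begin

abbreviation U :: "real \<Rightarrow> real" where "U t \<equiv> measure M {0<..<t}"

abbreviation V :: "real \<Rightarrow> real" where "V t \<equiv> measure N {0<..<t}"

definition excess :: "real \<Rightarrow> real \<Rightarrow> real" where
  "excess l t = U t - l * V t"

definition max_excess :: "real \<Rightarrow> real" where
  "max_excess l = (SUP t\<in>{0..}. excess l t)"

text \<open>Points to the left of near maximum points, rather than of maximum points, because the supremum of
  $U - lV$ may be approached only at infinity; the level set is then the whole half-line.\<close>

definition level_set :: "real \<Rightarrow> real set" where
  "level_set l = {x. 0 < x \<and> (\<forall>e>0. \<exists>t\<ge>x. max_excess l - e < excess l t)}"

lemma U_le: "U t \<le> measure M {0<..}"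
  using M_finite by (intro measure_mono_fmeasurable fmeasurableI) (auto intro: M.sets_borel)

lemma V_pos: "0 < t \<Longrightarrow> 0 < V t"
  using N_pos[of t] N.measure_initial[of t] by (simp add: zero_less_measure_iff)

lemma continuous_on_excess: "continuous_on UNIV (excess l)"
  unfolding excess_def
  by (intro continuous_intros M.continuous_on_measure_initial N.continuous_on_measure_initial)

lemma excess_0 [simp]: "excess l 0 = 0"
  by (simp add: excess_def)

lemma excess_le: "0 \<le> l \<Longrightarrow> excess l t \<le> measure M {0<..}"
  unfolding excess_def using U_le[of t] by (smt (verit) measure_nonneg mult_nonneg_nonneg)

lemma excess_le_max: "0 \<le> l \<Longrightarrow> 0 \<le> t \<Longrightarrow> excess l t \<le> max_excess l"
  unfolding max_excess_def
  by (rule cSUP_upper) (auto intro!: bdd_aboveI2 excess_le)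

lemma max_excess_nonneg: "0 \<le> l \<Longrightarrow> 0 \<le> max_excess l"
  using excess_le_max[of l 0] by simp

lemma max_excess_le: "(\<And>t. 0 \<le> t \<Longrightarrow> excess l t \<le> c) \<Longrightarrow> max_excess l \<le> c"
  unfolding max_excess_def by (rule cSUP_least) auto

lemma max_excess_le_measure: "0 \<le> l \<Longrightarrow> max_excess l \<le> measure M {0<..}"
  by (intro max_excess_le excess_le)

text \<open>If some $y$ lies outside the level set, then the supremum is not approached beyond $y$, so by
  continuity it is attained on $[0,y]$, and the set of maximum points there is compact. The level set
  ends at the largest of them, with the value $T = 0$ standing for an empty level set.\<close>

lemma level_set_cases:
  assumes l: "0 \<le> l"
  obtains "level_set l = {0<..}"
  | T where "0 \<le> T" "level_set l = {0<..T}" "excess l T = max_excess l"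
proof (cases "level_set l = {0<..}")
  case False
  then obtain y where y: "0 < y" "y \<notin> level_set l"
    by (auto simp: level_set_def)
  then obtain e where e: "0 < e" "\<And>t. y \<le> t \<Longrightarrow> excess l t \<le> max_excess l - e"
    by (auto simp: level_set_def not_less)
  have cont: "continuous_on A (excess l)" for A
    using continuous_on_excess continuous_on_subset by blast
  obtain t0 where t0: "t0 \<in> {0..y}" "\<And>t. t \<in> {0..y} \<Longrightarrow> excess l t \<le> excess l t0"
    using continuous_attains_sup[OF compact_Icc _ cont, of 0 y] y by auto
  \<comment> \<open>to the right of y the excess stays e below the supremum, so the maximum on [0,y] is global\<close>
  have "max_excess l \<le> max (excess l t0) (max_excess l - e)"
  proof (rule max_excess_le)
    fix t :: real assume "0 \<le> t"
    then show "excess l t \<le> max (excess l t0) (max_excess l - e)"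
      using t0(2)[of t] e(2)[of t] by (cases "t \<le> y") auto
  qed
  then have "excess l t0 = max_excess l"
    using e(1) excess_le_max[OF l, of t0] t0(1) by auto
  moreover have "closed {t. excess l t = max_excess l}"
    using continuous_on_excess by (intro closed_Collect_eq) auto
  then have "compact ({0..y} \<inter> {t. excess l t = max_excess l})"
    by (intro compact_Int_closed) auto
  moreover have "{0..y} \<inter> {t. excess l t = max_excess l} \<noteq> {}"
    using calculation(1) t0(1) by blast
  ultimately obtain T where T: "T \<in> {0..y} \<inter> {t. excess l t = max_excess l}"
      and "\<forall>t\<in>{0..y} \<inter> {t. excess l t = max_excess l}. t \<le> T"
    using compact_attains_sup[of "{0..y} \<inter> {t. excess l t = max_excess l}"] by blast
  then have T_max: "t \<le> T" if "t \<in> {0..y}" "excess l t = max_excess l" for t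
    using that by blast
  have "level_set l = {0<..T}"
  proof (intro set_eqI iffI)
    fix x assume "x \<in> {0<..T}"
    then show "x \<in> level_set l"
      using T by (auto simp: level_set_def intro!: exI[of _ T])
  next
    fix x assume x: "x \<in> level_set l"
    have "x < y"
    proof (rule ccontr)
      assume "\<not> x < y"
      moreover obtain t where "x \<le> t" "max_excess l - e < excess l t"
        using x e(1) unfolding level_set_def by blast
      ultimately show False
        using e(2)[of t] by simp
    qed
    have "x \<le> T"
    proof (rule ccontr)
      assume "\<not> x \<le> T"
      obtain t1 where t1: "t1 \<in> {x..y}" "\<And>t. t \<in> {x..y} \<Longrightarrow> excess l t \<le> excess l t1"
        using continuous_attains_sup[OF compact_Icc _ cont, of x y] \<open>x < y\<close> by auto
      have "0 < x" using x by (simp add: level_set_def)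
      then have "excess l t1 < max_excess l"
        using T_max[of t1] t1(1) \<open>\<not> x \<le> T\<close> excess_le_max[OF l, of t1] by force
      then have "0 < min e (max_excess l - excess l t1)" using e(1) by simp
      then obtain t where "x \<le> t" "max_excess l - min e (max_excess l - excess l t1) < excess l t"
        using x unfolding level_set_def by blast
      then show False
        using e(2)[of t] t1(2)[of t] by (cases "t \<le> y") (simp_all add: min_def split: if_splits)
    qed
    then show "x \<in> {0<..T}" using x by (simp add: level_set_def)
  qed
  then show thesis using that(2) T by auto
qed (rule that(1))

lemma initial_segment_level_set:
  assumes "0 \<le> l"
  shows "initial_segment (level_set l)"
  using assms
proof (cases rule: level_set_cases)
  case 1
  then show ?thesis by (simp add: initial_segment_def subset_eq)
next
  case (2 T)
  then show ?thesis by (simp add: initial_segment_def subset_eq)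
qed

lemma level_set_sets: "0 \<le> l \<Longrightarrow> level_set l \<in> sets M" "0 \<le> l \<Longrightarrow> level_set l \<in> sets N"
  by (simp_all add: M.initial_sets N.initial_sets initial_segment_level_set)

text \<open>A point $t \<ge> x$ that is nearly optimal for the slope $l$ is a competitor for the slope $l'$, where
  its excess is larger by $(l - l') V(t)$.\<close>

lemma max_excess_gain:
  assumes "0 \<le> l'" "l' \<le> l" "x \<in> level_set l"
  shows "max_excess l + (l - l') * V x \<le> max_excess l'"
proof (rule field_le_epsilon)
  fix e :: real assume "0 < e"
  then obtain t where t: "x \<le> t" "max_excess l - e < excess l t"
    using assms(3) by (auto simp: level_set_def)
  have "0 < x" using assms(3) by (simp add: level_set_def)
  have "max_excess l + (l - l') * V x \<le> excess l t + e + (l - l') * V t"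
    using t assms(2) by (intro add_mono mult_left_mono N.measure_initial_mono) auto
  also have "\<dots> = excess l' t + e"
    by (simp add: excess_def algebra_simps)
  also have "\<dots> \<le> max_excess l' + e"
    using excess_le_max[OF assms(1), of t] t \<open>0 < x\<close> by simp
  finally show "max_excess l + (l - l') * V x \<le> max_excess l' + e" .
qed

text \<open>This bounds the mass of a level set by a decrement of the maximal excess. Along a sequence of slopes
  the decrements telescope, which is how the total mass of $M$ comes to control the integral of the
  level function.\<close>

lemma emeasure_level_set_le:
  assumes "0 \<le> l'" "l' \<le> l"
  shows "ennreal (l - l') * emeasure N (level_set l) \<le> ennreal (max_excess l' - max_excess l)"
proof -
  have bound: "ennreal (l - l') * emeasure N {0<..<x} \<le> ennreal (max_excess l' - max_excess l)"
    if "x \<in> level_set l" for x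
    using max_excess_gain[OF assms that] assms(2)
    by (simp add: N.measure_initial ennreal_leI flip: ennreal_mult)
  have l: "0 \<le> l" using assms by simp
  show ?thesis
  proof (rule level_set_cases[OF l])
    assume all: "level_set l = {0<..}"
    have "ennreal (l - l') * emeasure N {0<..<real n} \<le> ennreal (max_excess l' - max_excess l)" for n
      using bound[of "real n"] all by (cases n) auto
    then show ?thesis
      unfolding all N.emeasure_half_line by (auto simp: SUP_mult_left_ennreal intro!: SUP_least)
  next
    fix T assume "0 \<le> T" "level_set l = {0<..T}"
    then show ?thesis
      using bound[of T] by (cases "T = 0") (auto simp: N.emeasure_closed_initial)
  qed
qed

text \<open>Lowering the slope rewards large $t$: the gain $(l - l')V(t)$ increases with $t$, so a near maximum
  to the right of $x$ cannot be overtaken by points to the left of $x$.\<close>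

lemma level_set_antimono:
  assumes "0 \<le> l'" "l' \<le> l"
  shows "level_set l \<subseteq> level_set l'"
proof
  fix x assume x: "x \<in> level_set l"
  then have "0 < x" by (simp add: level_set_def)
  have "\<exists>t\<ge>x. max_excess l' - e < excess l' t" if "0 < e" for e
  proof (rule ccontr)
    assume no: "\<not> (\<exists>t\<ge>x. max_excess l' - e < excess l' t)"
    obtain t where t: "x \<le> t" "max_excess l - e / 2 < excess l t"
      using x \<open>0 < e\<close> half_gt_zero[of e] unfolding level_set_def by blast
    have shift: "excess l' s = excess l s + (l - l') * V s" for s
      by (simp add: excess_def algebra_simps)
    have "max_excess l' \<le> max_excess l' - e / 2"
    proof (rule max_excess_le)
      fix s :: real assume "0 \<le> s"
      show "excess l' s \<le> max_excess l' - e / 2"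
      proof (cases "x \<le> s")
        case True
        then show ?thesis using no \<open>0 < e\<close> by force
      next
        case False
        have "excess l' s \<le> max_excess l + (l - l') * V t"
          unfolding shift[of s] using False t \<open>0 \<le> s\<close> assms
          by (intro add_mono mult_left_mono N.measure_initial_mono excess_le_max) auto
        also have "\<dots> \<le> excess l' t + e / 2"
          unfolding shift[of t] using t by simp
        also have "\<dots> \<le> max_excess l' - e / 2"
          using no t(1) by (force simp: not_less)
        finally show ?thesis .
      qed
    qed
    then show False using \<open>0 < e\<close> by simp
  qed
  then show "x \<in> level_set l'" using \<open>0 < x\<close> by (simp add: level_set_def)
qed

text \<open>Beyond the level set, which ends at a maximum point $T$ of $U - lV$, the difference
  $(U - lV)(s) - (U - lV)(T)$ is never positive; this says that $M$ has at most $l$ times the mass of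
  $N$ on $(T,s)$.\<close>

lemma emeasure_outside_level_set_le:
  assumes l: "0 \<le> l" and D: "initial_segment D" "D \<subseteq> {0<..<b}"
  shows "emeasure M (D - level_set l) \<le> ennreal l * emeasure N (D - level_set l)"
proof (rule level_set_cases[OF l])
  assume "level_set l = {0<..}"
  then have empty: "D - level_set l = {}" using D(2) by auto
  show ?thesis unfolding empty by simp
next
  fix T assume T: "0 \<le> T" "level_set l = {0<..T}" "excess l T = max_excess l"
  have interval: "emeasure M {T<..<s} \<le> ennreal l * emeasure N {T<..<s}" if "T \<le> s" for s
  proof -
    have "U s - U T \<le> l * (V s - V T)"
      using excess_le_max[OF l, of s] T that by (simp add: excess_def algebra_simps)
    then show ?thesis
      using that T(1) l N.measure_initial_mono[of T s]
      by (simp add: M.emeasure_interval N.emeasure_interval ennreal_leI flip: ennreal_mult)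
  qed
  consider "D = {0<..}" | s where "D = {0<..<s}" | s where "D = {0<..s}"
    using D(1) by (rule initial_segment_cases)
  then show ?thesis
  proof cases
    case 1
    then have "max 1 b \<in> D" by simp
    then have "max 1 b \<in> {0<..<b}" using D(2) by blast
    then show ?thesis by simp
  next
    case (2 s)
    then have eq: "D - level_set l = {T<..<s}" using T by auto
    show ?thesis
    proof (cases "T \<le> s")
      case True
      then show ?thesis unfolding eq by (rule interval)
    next
      case False
      then have "{T<..<s} = {}" by simp
      then show ?thesis unfolding eq by simp
    qed
  next
    case (3 s)
    show ?thesis
    proof (cases "T < s")
      case True
      then have eq: "D - level_set l = insert s {T<..<s}" using T 3 by auto
      have "0 < s" using T(1) True by linarith
      have "emeasure M (insert s {T<..<s}) = emeasure M {T<..<s}"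
        using T(1) \<open>0 < s\<close> by (intro M.emeasure_insert_point M.interval_sets)
      moreover have "emeasure N (insert s {T<..<s}) = emeasure N {T<..<s}"
        using T(1) \<open>0 < s\<close> by (intro N.emeasure_insert_point N.interval_sets)
      ultimately show ?thesis
        unfolding eq using interval[of s] True by simp
    next
      case False
      then have empty: "D - level_set l = {}" unfolding T(2) 3 by auto
      show ?thesis unfolding empty by simp
    qed
  qed
qed

lemma level_set_eventually_leaves:
  assumes "0 < x"
  obtains l0 where "0 < l0" "\<And>l. l0 \<le> l \<Longrightarrow> x \<notin> level_set l"
proof
  let ?l0 = "(measure M {0<..} + 1) / V x"
  show "0 < ?l0" using V_pos[OF assms] by (simp add: add_nonneg_pos)
  fix l assume l: "?l0 \<le> l"
  with \<open>0 < ?l0\<close> have "0 \<le> l" by simp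
  show "x \<notin> level_set l"
  proof
    assume "x \<in> level_set l"
    then have "l * V x \<le> measure M {0<..}"
      using max_excess_gain[of 0 l x] max_excess_nonneg[of l] max_excess_le_measure[of 0] \<open>0 \<le> l\<close>
      by auto
    moreover have "measure M {0<..} + 1 \<le> l * V x"
      using l V_pos[OF assms] by (simp add: divide_le_eq)
    ultimately show False by simp
  qed
qed

text \<open>On the geometric grid of slopes the level sets containing $x$ are those up to some last index: they
  decrease in the slope, and $x$ leaves them once the slope exceeds a multiple of $1/V(x)$.\<close>

lemma grid_level_cases:
  fixes r :: real
  assumes r: "1 < r" and x: "0 < x"
  obtains "\<And>k::int. x \<notin> level_set (r powi k)"
  | K :: int where "\<And>k. x \<in> level_set (r powi k) \<longleftrightarrow> k \<le> K"
proof (cases "\<exists>k::int. x \<in> level_set (r powi k)")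
  case True
  then obtain k0 :: int where k0: "x \<in> level_set (r powi k0)" ..
  have down: "x \<in> level_set (r powi k)" if "k \<le> k'" "x \<in> level_set (r powi k')" for k k' :: int
    using level_set_antimono[of "r powi k" "r powi k'"] power_int_increasing[of k k' r] that r by auto
  obtain l0 where l0: "0 < l0" "\<And>l. l0 \<le> l \<Longrightarrow> x \<notin> level_set l"
    using level_set_eventually_leaves[OF x] by blast
  obtain k1 :: int where "l0 \<le> r powi (k1 + 1)"
    using powi_bracket[OF r l0(1)] by blast
  then have k1: "x \<notin> level_set (r powi (k1 + 1))" using l0(2) by blast
  \<comment> \<open>the last index is found by counting upwards from an index whose level set contains x\<close>
  define n where "n = (LEAST n. x \<notin> level_set (r powi (k0 + int n)))"
  have "k0 < k1 + 1" using k0 k1 down[of "k1 + 1" k0] by (cases "k1 + 1 \<le> k0") auto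
  then have "x \<notin> level_set (r powi (k0 + int (nat (k1 + 1 - k0))))" using k1 by simp
  then have n: "x \<notin> level_set (r powi (k0 + int n))"
    unfolding n_def by (rule LeastI)
  then have "n \<noteq> 0" using k0 by (intro notI) simp
  then have "x \<in> level_set (r powi (k0 + int (n - 1)))"
    using not_less_Least[of "n - 1" "\<lambda>n. x \<notin> level_set (r powi (k0 + int n))"] by (simp add: n_def)
  then have last: "x \<in> level_set (r powi (k0 + int n - 1))"
    using \<open>n \<noteq> 0\<close> by (simp add: of_nat_diff algebra_simps)
  have "x \<in> level_set (r powi k) \<longleftrightarrow> k \<le> k0 + int n - 1" for k
    using down[of k "k0 + int n - 1"] down[of "k0 + int n" k] last n by (cases "k \<le> k0 + int n - 1") auto
  then show thesis by (rule that(2))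
qed (use that(1) in blast)

text \<open>The function $F$ is the staircase of the level sets at the slopes $r^k$. On
  $J = (0,t) \<inter> S_k \<setminus> S_{k+1}$ it equals $r^{k+1}$, the slope for which $J$ lies outside the level set, so that
  $\<integral>_J F^{-1}\,dM \<le> N(J)$; summing over $k$ gives the bound for $1/F$. The integral of $F$
  telescopes to at most $r$ times the mass of $M$, the factor $r$ coming from the shift by one step
  of the grid. Where $F$ vanishes, all slopes $r^k$ bound the density of $M$, so $M$ has no mass there.\<close>

lemma exists_level_function:
  fixes r :: real
  assumes r: "1 < r"
  obtains F :: "real \<Rightarrow> real" where
    "\<And>x. 0 \<le> F x"
    "\<And>x y. 0 < x \<Longrightarrow> x \<le> y \<Longrightarrow> F y \<le> F x"
    "(\<integral>\<^sup>+x. ennreal (F x) \<partial>N) \<le> ennreal r * emeasure M {0<..}"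
    "\<And>t. (\<integral>\<^sup>+x\<in>{0<..<t}. ennreal (inverse (F x)) \<partial>M) \<le> emeasure N {0<..<t}"
    "AE x in M. F x \<noteq> 0"
proof -
  define S where "S k = level_set (r powi k)" for k
  define F where "F x = enn2real (staircase r S x)" for x
  have powi_pos: "0 < r powi k" for k using r by simp
  have S_sets[measurable]: "S k \<in> sets M" "S k \<in> sets N" for k
    using powi_pos[of k] by (simp_all add: S_def level_set_sets)
  have stair_cases: "(\<forall>k. x \<notin> S k) \<and> staircase r S x = 0
      \<or> (\<exists>K. (\<forall>k. x \<in> S k \<longleftrightarrow> k \<le> K) \<and> staircase r S x = ennreal (r powi (K + 1)))" if "0 < x" for x
    using r that
  proof (cases rule: grid_level_cases)
    case 1
    then show ?thesis by (simp add: S_def staircase_eq_0)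
  next
    case (2 K)
    then show ?thesis
      using staircase_eq_if_initial[OF r, of x S K] by (auto simp: S_def)
  qed
  have F_cases: "(\<forall>k. x \<notin> S k) \<and> F x = 0 \<or> (\<exists>K. (\<forall>k. x \<in> S k \<longleftrightarrow> k \<le> K) \<and> F x = r powi (K + 1))"
    if "0 < x" for x
    using stair_cases[OF that] less_imp_le[OF powi_pos] unfolding F_def by fastforce
  show thesis
  proof (rule that[of F])
    show "0 \<le> F x" for x by (simp add: F_def)
  next
    fix x y :: real assume xy: "0 < x" "x \<le> y"
    have "x \<in> S k" if "y \<in> S k" for k
      using initial_segment_level_set[of "r powi k"] powi_pos[of k] that xy
      unfolding S_def initial_segment_def by (meson greaterThanAtMost_iff less_imp_le subsetD)
    then have "staircase r S y \<le> staircase r S x"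
      by (rule staircase_mono)
    moreover have "staircase r S x < top"
      using stair_cases[OF xy(1)] by auto
    ultimately show "F y \<le> F x" by (simp add: F_def enn2real_mono)
  next
    have "(\<integral>\<^sup>+x. ennreal (F x) \<partial>N) \<le> (\<integral>\<^sup>+x. staircase r S x \<partial>N)"
      by (intro nn_integral_mono) (simp add: F_def ennreal_enn2real_if)
    also have "\<dots> = (\<integral>\<^sup>+k. ennreal (r powi (k + 1) - r powi k) * emeasure N (S k) \<partial>count_space UNIV)"
      by (rule nn_integral_staircase) simp
    also have "\<dots> \<le> (\<integral>\<^sup>+k. ennreal r * ennreal (max_excess (r powi (k - 1)) - max_excess (r powi k)) \<partial>count_space UNIV)"
    proof (rule nn_integral_mono)
      fix k :: int
      have "r powi (k + 1) - r powi k = r * (r powi k - r powi (k - 1))"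
        using r by (simp add: power_int_add power_int_diff field_simps)
      moreover have "r powi (k - 1) \<le> r powi k"
        using r by (intro power_int_increasing) auto
      ultimately have "ennreal (r powi (k + 1) - r powi k) * emeasure N (S k)
          = ennreal r * (ennreal (r powi k - r powi (k - 1)) * emeasure N (S k))"
        using r by (simp add: ennreal_mult mult.assoc)
      also have "\<dots> \<le> ennreal r * ennreal (max_excess (r powi (k - 1)) - max_excess (r powi k))"
        unfolding S_def using powi_pos[of "k - 1"] \<open>r powi (k - 1) \<le> r powi k\<close>
        by (intro mult_left_mono emeasure_level_set_le) auto
      finally show "ennreal (r powi (k + 1) - r powi k) * emeasure N (S k)
          \<le> ennreal r * ennreal (max_excess (r powi (k - 1)) - max_excess (r powi k))" .
    qed
    also have "\<dots> = ennreal r * (\<integral>\<^sup>+k. ennreal (max_excess (r powi (k - 1)) - max_excess (r powi k)) \<partial>count_space UNIV)"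
      by (rule nn_integral_cmult) simp
    also have "\<dots> \<le> ennreal r * ennreal (measure M {0<..})"
    proof (intro mult_left_mono nn_integral_telescoping_int_le)
      fix k :: int
      show "0 \<le> max_excess (r powi k)" "max_excess (r powi k) \<le> measure M {0<..}"
        using powi_pos[of k] by (simp_all add: max_excess_nonneg max_excess_le_measure)
      have "r powi (k - 1) \<le> r powi k"
        using r by (intro power_int_increasing) auto
      then have "excess (r powi k) t \<le> excess (r powi (k - 1)) t" for t
        unfolding excess_def by (intro diff_left_mono mult_right_mono) auto
      moreover have "excess (r powi (k - 1)) t \<le> max_excess (r powi (k - 1))" if "0 \<le> t" for t
        using powi_pos[of "k - 1"] that by (intro excess_le_max) auto
      ultimately show "max_excess (r powi k) \<le> max_excess (r powi (k - 1))"
        by (intro max_excess_le) (rule order_trans)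
    qed simp
    also have "ennreal (measure M {0<..}) = emeasure M {0<..}"
      using M_finite by (intro emeasure_eq_ennreal_measure[symmetric]) auto
    finally show "(\<integral>\<^sup>+x. ennreal (F x) \<partial>N) \<le> ennreal r * emeasure M {0<..}" .
  next
    fix t :: real
    define J where "J k = ({0<..<t} \<inter> S k) - S (k + 1)" for k
    have J_sets[measurable]: "J k \<in> sets M" "J k \<in> sets N" for k
      unfolding J_def by (auto intro!: sets.Int sets.Diff)
    have J_le: "emeasure M (J k) \<le> ennreal (r powi (k + 1)) * emeasure N (J k)" for k
      unfolding J_def S_def
    proof (rule emeasure_outside_level_set_le)
      show "initial_segment ({0<..<t} \<inter> level_set (r powi k))"
        using initial_segment_level_set[of "r powi k"] powi_pos[of k]
        by (intro initial_segment_Int) (auto simp: initial_segment_def)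
    next
      show "0 \<le> r powi (k + 1)" using powi_pos[of "k + 1"] by simp
      show "{0<..<t} \<inter> level_set (r powi k) \<subseteq> {0<..<t}" by simp
    qed
    have "(\<integral>\<^sup>+x\<in>{0<..<t}. ennreal (inverse (F x)) \<partial>M)
        \<le> (\<integral>\<^sup>+x. \<integral>\<^sup>+k. ennreal (inverse (r powi (k + 1))) * indicator (J k) x \<partial>count_space UNIV \<partial>M)"
    proof (rule nn_integral_mono)
      fix x assume "x \<in> space M"
      then have "0 < x" by (simp add: M.space_eq)
      show "ennreal (inverse (F x)) * indicator {0<..<t} x
          \<le> (\<integral>\<^sup>+k. ennreal (inverse (r powi (k + 1))) * indicator (J k) x \<partial>count_space UNIV)"
        using F_cases[OF \<open>0 < x\<close>]
      proof (elim disjE exE conjE)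
        fix K assume K: "\<forall>k. x \<in> S k \<longleftrightarrow> k \<le> K" "F x = r powi (K + 1)"
        have "ennreal (inverse (F x)) * indicator {0<..<t} x
            = ennreal (inverse (r powi (K + 1))) * indicator (J K) x"
          using K by (auto simp: J_def indicator_def)
        also have "\<dots> \<le> (\<integral>\<^sup>+k. ennreal (inverse (r powi (k + 1))) * indicator (J k) x \<partial>count_space UNIV)"
          by (rule nn_integral_ge_point) simp
        finally show ?thesis .
      qed simp
    qed
    also have "\<dots> = (\<integral>\<^sup>+k. ennreal (inverse (r powi (k + 1))) * emeasure M (J k) \<partial>count_space UNIV)"
      by (subst nn_integral_count_space_nn_integral) (auto simp: nn_integral_cmult)
    also have "\<dots> \<le> (\<integral>\<^sup>+k. emeasure N (J k) \<partial>count_space UNIV)"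
    proof (rule nn_integral_mono)
      fix k
      have "ennreal (inverse (r powi (k + 1))) * emeasure M (J k)
          \<le> ennreal (inverse (r powi (k + 1))) * (ennreal (r powi (k + 1)) * emeasure N (J k))"
        by (intro mult_left_mono J_le) simp
      also have "\<dots> = ennreal (inverse (r powi (k + 1)) * r powi (k + 1)) * emeasure N (J k)"
        using powi_pos[of "k + 1"] by (simp add: ennreal_mult mult.assoc)
      also have "inverse (r powi (k + 1)) * r powi (k + 1) = 1"
        using powi_pos[of "k + 1"] by (intro left_inverse less_imp_neq[THEN not_sym])
      finally show "ennreal (inverse (r powi (k + 1))) * emeasure M (J k) \<le> emeasure N (J k)"
        by simp
    qed
    also have "\<dots> = emeasure N (\<Union>k. J k)"
    proof (rule emeasure_UN_countable[symmetric])
      show "disjoint_family_on J UNIV"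
        unfolding disjoint_family_on_def
      proof safe
        fix j k :: int and x assume "j \<noteq> k" and x: "x \<in> J j" "x \<in> J k"
        then have "0 < x" by (simp add: J_def)
        from F_cases[OF this] x obtain K where "\<forall>k. x \<in> S k \<longleftrightarrow> k \<le> K"
          by (auto simp: J_def)
        then have "j = K" "k = K" using x by (auto simp: J_def)
        with \<open>j \<noteq> k\<close> show "x \<in> {}" by simp
      qed
    qed auto
    also have "\<dots> \<le> emeasure N {0<..<t}"
      by (rule emeasure_mono) (auto simp: J_def)
    finally show "(\<integral>\<^sup>+x\<in>{0<..<t}. ennreal (inverse (F x)) \<partial>M) \<le> emeasure N {0<..<t}" .
  next
    have null: "({0<..<real n} - (\<Union>k. S k)) \<in> null_sets M" for n
    proof -
      let ?Z = "{0<..<real n} - (\<Union>k. S k)"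
      have Z_sets: "?Z \<in> sets M" by (intro sets.Diff sets.countable_UN') auto
      have "emeasure M ?Z \<le> 0"
      proof (rule ennreal_le_epsilon)
        fix e :: real assume "0 < e"
        \<comment> \<open>the summand 1 keeps the denominator positive also when n = 0\<close>
        obtain k :: int where k: "r powi k < e / (V (real n) + 1)"
          using powi_bracket[OF r, of "e / (V (real n) + 1)"] \<open>0 < e\<close> by (auto simp: add_nonneg_pos)
        have "emeasure M ?Z \<le> emeasure M ({0<..<real n} - S k)"
          using Z_sets by (intro emeasure_mono) auto
        also have "\<dots> \<le> ennreal (r powi k) * emeasure N ({0<..<real n} - S k)"
          unfolding S_def using powi_pos[of k]
          by (intro emeasure_outside_level_set_le) (auto simp: initial_segment_def)
        also have "\<dots> \<le> ennreal (r powi k) * emeasure N {0<..<real n}"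
          by (intro mult_left_mono emeasure_mono) auto
        also have "\<dots> = ennreal (r powi k * V (real n))"
          using powi_pos[of k] by (simp add: N.measure_initial ennreal_mult)
        also have "r powi k * V (real n) \<le> e"
        proof -
          have "r powi k * V (real n) \<le> r powi k * (V (real n) + 1)"
            using powi_pos[of k] by simp
          also have "\<dots> \<le> e"
            using k by (simp add: pos_less_divide_eq add_nonneg_pos)
          finally show ?thesis .
        qed
        finally show "emeasure M ?Z \<le> 0 + ennreal e" by (simp add: ennreal_leI)
      qed
      then have "emeasure M ?Z = 0" by simp
      then show ?thesis using Z_sets by auto
    qed
    show "AE x in M. F x \<noteq> 0"
    proof (rule AE_I')
      show "(\<Union>n. {0<..<real n} - (\<Union>k. S k)) \<in> null_sets M"
        by (intro null_sets_UN null)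
      show "{x \<in> space M. \<not> F x \<noteq> 0} \<subseteq> (\<Union>n. {0<..<real n} - (\<Union>k. S k))"
      proof
        fix x assume "x \<in> {x \<in> space M. \<not> F x \<noteq> 0}"
        then have "x \<in> space M" "F x = 0" by auto
        then have "0 < x" by (simp add: M.space_eq)
        then have "\<forall>k. x \<notin> S k"
          using F_cases[of x] \<open>F x = 0\<close> powi_pos by (metis less_irrefl)
        moreover obtain n where "x < real n" using reals_Archimedean2 by blast
        ultimately show "x \<in> (\<Union>n. {0<..<real n} - (\<Union>k. S k))"
          using \<open>0 < x\<close> by auto
      qed
    qed
  qed
qed

end

section \<open>Powers and the decreasing majorant\<close>

lemma epowr_zero [simp]: "epowr 0 a = 0"
  by (simp add: epowr_def)

lemma epowr_top [simp]: "epowr top a = top"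
  by (simp add: epowr_def)

lemma epowr_one [simp]: "epowr x 1 = x"
  by (cases x) (auto simp: epowr_def)

lemma epowr_ennreal: "0 \<le> x \<Longrightarrow> epowr (ennreal x) a = ennreal (x powr a)"
  by (simp add: epowr_def)

lemma epowr_less_top_iff [simp]: "epowr x a < top \<longleftrightarrow> x < top"
  by (cases x) (auto simp: epowr_def)

lemma epowr_mono: "0 \<le> a \<Longrightarrow> x \<le> y \<Longrightarrow> epowr x a \<le> epowr y a"
  by (cases x; cases y) (auto simp: epowr_ennreal top_unique intro!: ennreal_leI powr_mono2)

lemma epowr_mult: "epowr (x * y) a = epowr x a * epowr y a"
proof (cases "x = 0 \<or> y = 0")
  case False
  then show ?thesis
    by (cases x; cases y)
      (auto simp: epowr_ennreal powr_mult ennreal_mult_top ennreal_top_mult simp flip: ennreal_mult)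
qed auto

lemma epowr_epowr: "epowr (epowr x a) b = epowr x (a * b)"
  by (cases x) (auto simp: epowr_ennreal powr_powr)

lemma epowr_measurable [measurable]:
  assumes [measurable]: "f \<in> borel_measurable M"
  shows "(\<lambda>x. epowr (f x) a) \<in> borel_measurable M"
  unfolding epowr_def infinity_ennreal_def by measurable

lemma decreasing_majorant_antimono:
  assumes f: "f \<in> borel_measurable half_line" and "0 < x" "x \<le> y"
  shows "decreasing_majorant f y \<le> decreasing_majorant f x"
proof -
  have [measurable]: "f \<in> borel_measurable (lebesgue_on {y..})"
    using f by (rule measurable_restrict_mono) (use assms in auto)
  have "AE t in lebesgue_on {x..}. ennreal \<bar>f t\<bar> \<le> decreasing_majorant f x"
    unfolding decreasing_majorant_def by (rule esssup_AE)
  then have "AE t in lebesgue_on {y..}. ennreal \<bar>f t\<bar> \<le> decreasing_majorant f x"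
    using \<open>x \<le> y\<close> by (auto simp: AE_restrict_space_iff elim!: eventually_mono)
  then show ?thesis
    unfolding decreasing_majorant_def[of f y] by (intro esssup_I) measurable
qed

lemma decreasing_majorant_le_if_antimono:
  assumes f: "f \<in> borel_measurable half_line"
    and nonneg: "\<And>x. 0 \<le> f x" and anti: "\<And>x y. 0 < x \<Longrightarrow> x \<le> y \<Longrightarrow> f y \<le> f x"
    and x: "0 < x"
  shows "decreasing_majorant f x \<le> ennreal (f x)"
proof -
  have [measurable]: "f \<in> borel_measurable (lebesgue_on {x..})"
    using f by (rule measurable_restrict_mono) (use assms in auto)
  show ?thesis
    unfolding decreasing_majorant_def
    using nonneg anti x by (intro esssup_I AE_I2) (auto simp: space_restrict_space intro!: ennreal_leI)
qed

text \<open>The essential supremum gives a bound off a null set that depends on the left end point of the tail,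
  so it cannot be evaluated along the diagonal directly. Fix instead a level $s$: the set where the
  majorant is at most $s$ is a final segment, which apart from its end point is a countable union of
  tails with rational end points, and on each of these $|f| \<le> s$ almost everywhere. Countably
  many levels $s$ suffice to compare the two functions.\<close>

lemma AE_abs_le_decreasing_majorant:
  assumes f[measurable]: "f \<in> borel_measurable half_line"
  shows "AE x in half_line. ennreal \<bar>f x\<bar> \<le> decreasing_majorant f x"
proof -
  have level: "AE x in half_line. decreasing_majorant f x \<le> s \<longrightarrow> ennreal \<bar>f x\<bar> \<le> s" for s :: ennreal
  proof -
    define P where "P = {x\<in>{0<..}. decreasing_majorant f x \<le> s}"
    have tail: "AE t in half_line. x \<le> t \<longrightarrow> ennreal \<bar>f t\<bar> \<le> s" if "x \<in> P" for x
    proof -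
      have "AE t in lebesgue_on {x..}. ennreal \<bar>f t\<bar> \<le> decreasing_majorant f x"
        unfolding decreasing_majorant_def by (rule esssup_AE)
      then show ?thesis
        using that by (auto simp: AE_restrict_space_iff P_def elim!: eventually_mono)
    qed
    show ?thesis
    proof (cases "P = {}")
      case True
      then show ?thesis by (intro AE_I2) (auto simp: P_def space_restrict_space)
    next
      case False
      have bdd: "bdd_below P" by (rule bdd_belowI[of _ 0]) (auto simp: P_def)
      have rat_in_P: "of_rat q \<in> P" if "Inf P < of_rat q" for q
      proof -
        have "\<exists>x\<in>P. x < of_rat q"
          using that by (simp only: cInf_less_iff[OF False bdd])
        then obtain x where x: "x \<in> P" "x < of_rat q" by blast
        then have "0 < x" "decreasing_majorant f x \<le> s" by (simp_all add: P_def)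
        moreover have "decreasing_majorant f (of_rat q) \<le> decreasing_majorant f x"
          using x(2) \<open>0 < x\<close> by (intro decreasing_majorant_antimono f) simp_all
        moreover have "0 < real_of_rat q" using x(2) \<open>0 < x\<close> by (rule less_trans[rotated])
        ultimately show ?thesis
          unfolding P_def by (blast intro: order_trans greaterThan_iff[THEN iffD2])
      qed
      have "AE t in half_line. \<forall>q::rat. Inf P < of_rat q \<longrightarrow> of_rat q \<le> t \<longrightarrow> ennreal \<bar>f t\<bar> \<le> s"
        unfolding AE_all_countable
      proof
        fix q :: rat
        show "AE t in half_line. Inf P < of_rat q \<longrightarrow> of_rat q \<le> t \<longrightarrow> ennreal \<bar>f t\<bar> \<le> s"
          using tail[OF rat_in_P, of q] by (cases "Inf P < of_rat q") simp_all
      qed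
      moreover have "AE t in half_line. t \<noteq> Inf P"
        using AE_completion[OF AE_lborel_singleton[of "Inf P"]]
        by (auto simp: AE_restrict_space_iff elim!: eventually_mono)
      ultimately show ?thesis
        using AE_space
      proof eventually_elim
        case (elim t)
        show ?case
        proof
          assume "decreasing_majorant f t \<le> s"
          then have "t \<in> P" using elim(3) by (simp add: P_def space_restrict_space)
          then have "Inf P < t" using elim(2) cInf_lower[OF _ bdd, of t] by simp
          then obtain q where "Inf P < of_rat q" "of_rat q < t" using of_rat_dense by blast
          then show "ennreal \<bar>f t\<bar> \<le> s" using elim(1) by auto
        qed
      qed
    qed
  qed
  have "AE x in half_line. \<forall>q::rat. decreasing_majorant f x \<le> ennreal (of_rat q) \<longrightarrow> ennreal \<bar>f x\<bar> \<le> ennreal (of_rat q)"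
    unfolding AE_all_countable using level by blast
  then show ?thesis
  proof eventually_elim
    case (elim x)
    show ?case
    proof (rule ccontr)
      assume less: "\<not> ennreal \<bar>f x\<bar> \<le> decreasing_majorant f x"
      then obtain m where m: "0 \<le> m" "decreasing_majorant f x = ennreal m"
        by (cases "decreasing_majorant f x") auto
      then have "m < \<bar>f x\<bar>" using less by (simp add: ennreal_less_iff not_le)
      then obtain q where q: "m < of_rat q" "of_rat q < \<bar>f x\<bar>" using of_rat_dense by blast
      then have "0 \<le> real_of_rat q" using m(1) by linarith
      with q show False
        using elim[rule_format, of q] m by (simp add: ennreal_leI ennreal_le_iff)
    qed
  qed
qed

section \<open>The factorization theorem\<close>

lemma set_nn_integral_initial:
  assumes [measurable]: "w \<in> borel_measurable half_line"
  shows "(\<integral>\<^sup>+x\<in>{0<..<t}. w x \<partial>lebesgue) = emeasure (density half_line w) {0<..<t}"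
proof -
  have "emeasure (density half_line w) {0<..<t} = (\<integral>\<^sup>+x\<in>{0<..<t}. w x \<partial>half_line)"
    by (intro emeasure_density sets_half_line_borel) auto
  also have "\<dots> = (\<integral>\<^sup>+x. w x * indicator {0<..<t} x * indicator {0<..} x \<partial>lebesgue)"
    by (intro nn_integral_restrict_space) auto
  also have "\<dots> = (\<integral>\<^sup>+x\<in>{0<..<t}. w x \<partial>lebesgue)"
    by (intro nn_integral_cong) (auto simp: indicator_def)
  finally show ?thesis ..
qed

lemma half_line_measure_density:
  assumes w[measurable]: "w \<in> borel_measurable half_line"
    and fin: "\<And>t. emeasure (density half_line w) {0<..<t} < \<infinity>"
  shows "half_line_measure (density half_line w)"
proof
  fix x :: real
  show "emeasure (density half_line w) {x} = 0"
  proof (cases "0 < x")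
    case True
    then have "{x} \<in> null_sets half_line"
      by (auto simp: null_sets_def emeasure_restrict_space sets_half_line_borel)
    then show ?thesis
      using absolutely_continuousI_density[OF w] by (auto simp: absolutely_continuous_def)
  next
    case False
    then have "{x} \<notin> sets (density half_line w)"
      using sets.sets_into_space[of "{x}" "density half_line w"] by (auto simp: space_restrict_space)
    then show ?thesis by (rule emeasure_notin_sets)
  qed
qed (use fin in auto)

definition weight_measure :: "(real \<Rightarrow> real) \<Rightarrow> real measure" where
  "weight_measure v = density half_line (\<lambda>x. ennreal (v x))"

definition power_measure :: "real \<Rightarrow> (real \<Rightarrow> real) \<Rightarrow> (real \<Rightarrow> real) \<Rightarrow> real measure" where
  "power_measure q v h = density half_line (\<lambda>x. epowr (ennreal \<bar>h x\<bar>) q * ennreal (v x))"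

lemma sets_power_measure [simp, measurable_cong]: "sets (power_measure q v h) = sets half_line"
  by (simp add: power_measure_def)

lemma sets_weight_measure [simp, measurable_cong]: "sets (weight_measure v) = sets half_line"
  by (simp add: weight_measure_def)

lemma weight_measurable: "weight v \<Longrightarrow> v \<in> borel_measurable half_line"
  by (simp add: weight_def)

lemma primitive_eq: "weight v \<Longrightarrow> primitive v t = emeasure (weight_measure v) {0<..<t}"
  unfolding primitive_def weight_measure_def
  using weight_measurable by (intro set_nn_integral_initial) simp

lemma primitive_finite:
  assumes "weight v"
  shows "primitive v t < \<infinity>"
proof (cases "0 < t")
  case True
  then have "set_integrable lebesgue {0<..<t} v"
    using assms by (simp add: weight_def)
  then have "(\<integral>\<^sup>+x. ennreal (norm (indicator {0<..<t} x *\<^sub>R v x)) \<partial>lebesgue) < \<infinity>"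
    by (simp add: set_integrable_def integrable_iff_bounded)
  moreover have "primitive v t \<le> (\<integral>\<^sup>+x. ennreal (norm (indicator {0<..<t} x *\<^sub>R v x)) \<partial>lebesgue)"
    unfolding primitive_def by (intro nn_integral_mono) (auto simp: indicator_def intro!: ennreal_leI)
  ultimately show ?thesis by (rule le_less_trans[rotated])
qed (simp add: primitive_def)

lemma primitive_pos:
  assumes v: "weight v" and t: "0 < t"
  shows "0 < primitive v t"
proof -
  have [measurable]: "v \<in> borel_measurable half_line" using v by (rule weight_measurable)
  have [measurable]: "{0<..<t} \<in> sets half_line" by (auto intro: sets_half_line_borel)
  have "primitive v t \<noteq> 0"
  proof
    assume "primitive v t = 0"
    then have "AE x in half_line. ennreal (v x) * indicator {0<..<t} x = 0"
      by (simp add: primitive_eq[OF v] weight_measure_def emeasure_density nn_integral_0_iff_AE)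
    moreover have "AE x in half_line. 0 < v x" using v by (simp add: weight_def)
    ultimately have "AE x in half_line. x \<notin> {0<..<t}"
      by eventually_elim (auto simp: indicator_def split: if_splits)
    then have "emeasure half_line {0<..<t} = 0"
      by (subst (asm) AE_iff_measurable[of "{0<..<t}"]) (auto simp: space_restrict_space)
    then show False
      using t by (simp add: emeasure_restrict_space subset_eq)
  qed
  then show ?thesis by (simp add: zero_less_iff_neq_zero)
qed

lemma half_line_measure_weight:
  assumes "weight v"
  shows "half_line_measure (weight_measure v)"
  unfolding weight_measure_def
  using primitive_finite[OF assms] primitive_eq[OF assms] weight_measurable[OF assms]
  by (intro half_line_measure_density) (simp_all add: weight_measure_def)

lemma L_norm_finite_exponent:
  assumes v: "weight v" and h: "h \<in> borel_measurable half_line" and p: "p \<noteq> \<infinity>"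
  shows "L_norm p v h
    = epowr (emeasure (power_measure (enn2real p) v h) {0<..}) (1 / enn2real p)"
proof -
  have [measurable]: "v \<in> borel_measurable half_line" "h \<in> borel_measurable half_line"
    using v h weight_measurable by auto
  have "emeasure (power_measure (enn2real p) v h) {0<..}
      = (\<integral>\<^sup>+x. epowr (ennreal \<bar>h x\<bar>) (enn2real p) * ennreal (v x) * indicator {0<..} x \<partial>half_line)"
    unfolding power_measure_def by (intro emeasure_density sets_half_line_borel) auto
  also have "\<dots> = (\<integral>\<^sup>+x. epowr (ennreal \<bar>h x\<bar>) (enn2real p) * ennreal (v x) \<partial>half_line)"
    by (intro nn_integral_cong) (auto simp: space_restrict_space)
  finally show ?thesis using p by (simp add: L_norm_def)
qed

lemma G_norm_finite_exponent:
  assumes v: "weight v" and g: "g \<in> borel_measurable half_line" and p: "p \<noteq> \<infinity>"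
  shows "G_norm p v g = (SUP t\<in>{0<..}. epowr (emeasure (power_measure (enn2real p) v g) {0<..<t}
    / emeasure (weight_measure v) {0<..<t}) (1 / enn2real p))"
proof -
  have [measurable]: "v \<in> borel_measurable half_line" "g \<in> borel_measurable half_line"
    using v g weight_measurable by auto
  show ?thesis
    using p by (simp add: G_norm_def primitive_eq[OF v] power_measure_def set_nn_integral_initial)
qed

lemma D_norm_finite_exponent:
  assumes v: "weight v" and f: "f \<in> borel_measurable half_line" and p: "p \<noteq> \<infinity>"
  shows "D_norm p v f
    = epowr (\<integral>\<^sup>+x. epowr (decreasing_majorant f x) (enn2real p) \<partial>weight_measure v) (1 / enn2real p)"
proof -
  have [measurable]: "v \<in> borel_measurable half_line" "decreasing_majorant f \<in> borel_measurable half_line"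
    using v decreasing_majorant_antimono[OF f]
    by (auto intro: weight_measurable antimono_on_half_line_measurable)
  show ?thesis
    using p by (simp add: D_norm_def weight_measure_def nn_integral_density mult.commute)
qed

text \<open>For finite $p$, finiteness of the second norm says that the measure $|g|^p v\,dx$ is dominated by
  $\<parallel>g\<parallel>^p\, v\,dx$ on every interval $(0,t)$, and Hardy's lemma may be applied to the decreasing
  function \<^term>\<open>decreasing_majorant f\<close> raised to the power $p$.\<close>

lemma L_norm_le_D_norm_times_G_norm:
  assumes p: "0 < p" and v: "weight v"
    and h: "h \<in> borel_measurable half_line"
    and f: "f \<in> borel_measurable half_line" and g: "g \<in> borel_measurable half_line"
    and G_fin: "G_norm p v g < \<infinity>"
    and eq: "AE x in half_line. h x = f x * g x"
  shows "L_norm p v h \<le> D_norm p v f * G_norm p v g"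
proof (cases "p = \<infinity>")
  case True
  have "AE x in half_line. ennreal \<bar>f x\<bar> \<le> Linf_norm f" "AE x in half_line. ennreal \<bar>g x\<bar> \<le> Linf_norm g"
    unfolding Linf_norm_def by (rule esssup_AE)+
  then have "AE x in half_line. ennreal \<bar>h x\<bar> \<le> Linf_norm f * Linf_norm g"
    using eq by eventually_elim (auto simp: abs_mult ennreal_mult intro!: mult_mono)
  then have "Linf_norm h \<le> Linf_norm f * Linf_norm g"
    unfolding Linf_norm_def[of h] using h by (intro esssup_I) simp_all
  then show ?thesis using True by (simp add: L_norm_def D_norm_def G_norm_def)
next
  case False
  define q where "q = enn2real p"
  have q: "0 < q" using p False by (simp add: q_def enn2real_positive_iff less_top)
  have [measurable]: "v \<in> borel_measurable half_line" by (rule weight_measurable[OF v])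
  note [measurable] = h f g
  define N where "N = weight_measure v"
  define M where "M = power_measure q v g"
  define C where "C = epowr (G_norm p v g) q"
  have le: "emeasure M {0<..<t} \<le> C * emeasure N {0<..<t}" for t
  proof (cases "0 < t")
    case True
    have N: "emeasure N {0<..<t} \<noteq> 0" "emeasure N {0<..<t} \<noteq> top"
      using primitive_pos[OF v True] primitive_finite[OF v, of t]
      by (auto simp: N_def primitive_eq[OF v, symmetric])
    have "epowr (emeasure M {0<..<t} / emeasure N {0<..<t}) (1 / q) \<le> G_norm p v g"
      unfolding G_norm_finite_exponent[OF v g False] M_def N_def q_def
      using True by (intro SUP_upper) simp
    then have "epowr (epowr (emeasure M {0<..<t} / emeasure N {0<..<t}) (1 / q)) q \<le> C"
      unfolding C_def using q by (intro epowr_mono) auto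
    then have "emeasure M {0<..<t} / emeasure N {0<..<t} \<le> C"
      using q by (simp add: epowr_epowr)
    then have "emeasure M {0<..<t} / emeasure N {0<..<t} * emeasure N {0<..<t} \<le> C * emeasure N {0<..<t}"
      by (rule mult_right_mono) simp
    then show ?thesis
      using N by (simp add: ennreal_divide_times ennreal_times_divide mult_divide_eq_ennreal)
  qed simp
  have "emeasure M {0<..<t} < \<infinity>" for t
  proof -
    have "C < top" using G_fin by (simp add: C_def)
    then have "C * emeasure N {0<..<t} < top"
      using primitive_finite[OF v, of t]
      by (simp add: ennreal_mult_less_top N_def primitive_eq[OF v, symmetric])
    then show ?thesis using le[of t] by (simp add: le_less_trans)
  qed
  then have M: "half_line_measure M"
    unfolding M_def power_measure_def by (intro half_line_measure_density) simp_all
  have maj_meas [measurable]: "decreasing_majorant f \<in> borel_measurable half_line"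
    using decreasing_majorant_antimono[OF f] by (rule antimono_on_half_line_measurable)
  have "(\<integral>\<^sup>+x. epowr (ennreal \<bar>h x\<bar>) q * ennreal (v x) \<partial>half_line)
      \<le> (\<integral>\<^sup>+x. (epowr (ennreal \<bar>g x\<bar>) q * ennreal (v x)) * epowr (decreasing_majorant f x) q \<partial>half_line)"
  proof (rule nn_integral_mono_AE)
    show "AE x in half_line. epowr (ennreal \<bar>h x\<bar>) q * ennreal (v x)
        \<le> (epowr (ennreal \<bar>g x\<bar>) q * ennreal (v x)) * epowr (decreasing_majorant f x) q"
      using eq AE_abs_le_decreasing_majorant[OF f]
    proof eventually_elim
      case (elim x)
      have "epowr (ennreal \<bar>h x\<bar>) q = epowr (ennreal \<bar>f x\<bar>) q * epowr (ennreal \<bar>g x\<bar>) q"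
        by (simp add: elim(1) abs_mult ennreal_mult epowr_mult)
      also have "\<dots> \<le> epowr (decreasing_majorant f x) q * epowr (ennreal \<bar>g x\<bar>) q"
        using elim(2) q by (intro mult_right_mono epowr_mono) auto
      finally have "epowr (ennreal \<bar>h x\<bar>) q * ennreal (v x)
          \<le> epowr (decreasing_majorant f x) q * epowr (ennreal \<bar>g x\<bar>) q * ennreal (v x)"
        by (rule mult_right_mono) simp
      then show ?case by (simp add: ac_simps)
    qed
  qed
  also have "\<dots> = (\<integral>\<^sup>+x. epowr (decreasing_majorant f x) q \<partial>M)"
    unfolding M_def power_measure_def by (intro nn_integral_density[symmetric]) measurable
  also have "\<dots> \<le> C * (\<integral>\<^sup>+x. epowr (decreasing_majorant f x) q \<partial>N)"
    using le q by (intro nn_integral_antimono_le M epowr_mono decreasing_majorant_antimono f) (auto simp: N_def)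
  finally have "epowr (\<integral>\<^sup>+x. epowr (ennreal \<bar>h x\<bar>) q * ennreal (v x) \<partial>half_line) (1 / q)
      \<le> epowr (C * (\<integral>\<^sup>+x. epowr (decreasing_majorant f x) q \<partial>N)) (1 / q)"
    using q by (intro epowr_mono) auto
  also have "\<dots> = D_norm p v f * G_norm p v g"
    unfolding D_norm_finite_exponent[OF v f False] epowr_mult
    using q by (simp add: C_def N_def q_def epowr_epowr mult.commute)
  finally show ?thesis
    using False by (simp add: L_norm_def q_def)
qed

text \<open>For finite $p$, take a level function $F$ of $|h|^p v\,dx$ relative to $v\,dx$, with grid ratio $s^p$,
  and put $f = F^{1/p}$ and $g = h / f$. Then $f$ is decreasing, so its majorant does not exceed it,
  and $|g|^p v = F^{-1} |h|^p v$ has averages at most $1$. For $p = \<infinity>$ the trivial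
  factorization $h = h \<cdot> 1$ is optimal.\<close>

lemma exists_near_optimal_factorization:
  assumes p: "0 < p" and v: "weight v" and h: "h \<in> borel_measurable half_line"
    and L_fin: "L_norm p v h < \<infinity>" and s: "1 < s"
  shows "\<exists>(f, g) \<in> factorizations p v h. D_norm p v f * G_norm p v g \<le> ennreal s * L_norm p v h"
proof (cases "p = \<infinity>")
  case True
  have "emeasure lebesgue {0<..<1::real} \<le> emeasure lebesgue {0::real<..}"
    by (intro emeasure_mono) auto
  then have "emeasure half_line (space half_line) \<noteq> 0"
    by (auto simp: space_restrict_space emeasure_restrict_space)
  then have one: "Linf_norm (\<lambda>_. 1) = 1"
    unfolding Linf_norm_def by (subst esssup_const) auto
  have "1 * Linf_norm h \<le> ennreal s * Linf_norm h"
    using s by (intro mult_right_mono) auto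
  then have "(h, \<lambda>_. 1) \<in> factorizations p v h"
    "D_norm p v h * G_norm p v (\<lambda>_. 1) \<le> ennreal s * L_norm p v h"
    using L_fin h
    by (auto simp: True one L_norm_def D_norm_def G_norm_def factorizations_def D_space_def G_space_def)
  then show ?thesis by blast
next
  case False
  define q where "q = enn2real p"
  have q: "0 < q" using p False by (simp add: q_def enn2real_positive_iff less_top)
  have v_meas [measurable]: "v \<in> borel_measurable half_line" by (rule weight_measurable[OF v])
  note [measurable] = h
  define N where "N = weight_measure v"
  define M where "M = power_measure q v h"
  have L: "L_norm p v h = epowr (emeasure M {0<..}) (1 / q)"
    unfolding M_def q_def by (rule L_norm_finite_exponent[OF v h False])
  then have M_fin: "emeasure M {0<..} < \<infinity>" using L_fin by simp
  have "emeasure M {0<..<t} < \<infinity>" for t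
    using M_fin by (rule le_less_trans[rotated])
      (auto simp: M_def intro!: emeasure_mono sets_half_line_borel)
  then have M: "half_line_measure M"
    unfolding M_def power_measure_def by (intro half_line_measure_density) simp_all
  interpret level_function M N
    unfolding level_function_def level_function_axioms_def
    using M half_line_measure_weight[OF v] M_fin primitive_pos[OF v]
    by (simp add: N_def primitive_eq[OF v])
  have "1 < s powr q" using s q by (intro gr_one_powr) auto
  obtain F where F_nonneg: "\<And>x. 0 \<le> F x"
    and F_anti: "\<And>x y. 0 < x \<Longrightarrow> x \<le> y \<Longrightarrow> F y \<le> F x"
    and F_int: "(\<integral>\<^sup>+x. ennreal (F x) \<partial>N) \<le> ennreal (s powr q) * emeasure M {0<..}"
    and F_inv: "\<And>t. (\<integral>\<^sup>+x\<in>{0<..<t}. ennreal (inverse (F x)) \<partial>M) \<le> emeasure N {0<..<t}"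
    and F_nz: "AE x in M. F x \<noteq> 0"
    apply (rule exists_level_function[OF \<open>1 < s powr q\<close>])
    subgoal premises prems for F
      by (rule prems(1)) (fact prems)+
    done
  have F_meas [measurable]: "F \<in> borel_measurable half_line"
    using F_anti by (rule antimono_on_half_line_measurable)
  define f where "f x = F x powr (1 / q)" for x
  \<comment> \<open>where F = 0 the quotient is 0 by convention; h vanishes almost everywhere there\<close>
  define g where "g x = h x / f x" for x
  have [measurable]: "f \<in> borel_measurable half_line" "g \<in> borel_measurable half_line"
    unfolding f_def g_def by measurable
  have f_nonneg: "0 \<le> f x" for x
    by (simp add: f_def)
  have f_q: "f x powr q = F x" for x
    using q F_nonneg[of x] by (simp add: f_def powr_powr)
  have D: "D_norm p v f \<le> ennreal s * L_norm p v h"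
  proof -
    have "(\<integral>\<^sup>+x. epowr (decreasing_majorant f x) q \<partial>N) \<le> (\<integral>\<^sup>+x. ennreal (F x) \<partial>N)"
    proof (rule nn_integral_mono)
      fix x assume "x \<in> space N"
      then have "0 < x" by (simp add: N.space_eq)
      have "decreasing_majorant f x \<le> ennreal (f x)"
        using \<open>0 < x\<close> F_nonneg F_anti q
        by (intro decreasing_majorant_le_if_antimono) (auto simp: f_def intro!: powr_mono2)
      then have "epowr (decreasing_majorant f x) q \<le> epowr (ennreal (f x)) q"
        using q by (intro epowr_mono) auto
      then show "epowr (decreasing_majorant f x) q \<le> ennreal (F x)"
        using f_nonneg[of x] by (simp add: epowr_ennreal f_q)
    qed
    also note F_int
    also have "ennreal (s powr q) = epowr (ennreal s) q"
      using s by (simp add: epowr_ennreal)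
    finally have "epowr (\<integral>\<^sup>+x. epowr (decreasing_majorant f x) q \<partial>N) (1 / q)
        \<le> epowr (epowr (ennreal s) q * emeasure M {0<..}) (1 / q)"
      using q by (intro epowr_mono) auto
    then show ?thesis
      using q by (simp add: D_norm_finite_exponent[OF v _ False] L epowr_mult epowr_epowr N_def flip: q_def)
  qed
  have G: "G_norm p v g \<le> 1"
    unfolding G_norm_finite_exponent[OF v \<open>g \<in> borel_measurable half_line\<close> False] q_def[symmetric] N_def[symmetric]
  proof (rule SUP_least)
    fix t :: real assume t: "t \<in> {0<..}"
    have [measurable]: "{0<..<t} \<in> sets half_line" by (auto intro: sets_half_line_borel)
    have N: "emeasure N {0<..<t} \<noteq> 0" "emeasure N {0<..<t} < top"
      using t N_pos[of t] N.emeasure_initial_finite[of t] by auto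
    have "emeasure (power_measure q v g) {0<..<t}
        = (\<integral>\<^sup>+x. (epowr (ennreal \<bar>g x\<bar>) q * ennreal (v x)) * indicator {0<..<t} x \<partial>half_line)"
      unfolding power_measure_def by (intro emeasure_density sets_half_line_borel) auto
    also have "\<dots> = (\<integral>\<^sup>+x. (epowr (ennreal \<bar>h x\<bar>) q * ennreal (v x)) *
        (ennreal (inverse (F x)) * indicator {0<..<t} x) \<partial>half_line)"
    proof (rule nn_integral_cong)
      fix x
      have "\<bar>g x\<bar> powr q = \<bar>h x\<bar> powr q * inverse (F x)"
        using f_nonneg[of x] by (simp add: g_def abs_divide powr_divide f_q inverse_eq_divide)
      then have "epowr (ennreal \<bar>g x\<bar>) q = epowr (ennreal \<bar>h x\<bar>) q * ennreal (inverse (F x))"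
        using F_nonneg[of x] by (simp add: epowr_ennreal ennreal_mult)
      then show "(epowr (ennreal \<bar>g x\<bar>) q * ennreal (v x)) * indicator {0<..<t} x =
          (epowr (ennreal \<bar>h x\<bar>) q * ennreal (v x)) * (ennreal (inverse (F x)) * indicator {0<..<t} x)"
        by (simp add: ac_simps)
    qed
    also have "\<dots> = (\<integral>\<^sup>+x\<in>{0<..<t}. ennreal (inverse (F x)) \<partial>M)"
      unfolding M_def power_measure_def
      by (intro nn_integral_density[symmetric]) measurable
    also note F_inv[of t]
    finally have "emeasure (power_measure q v g) {0<..<t} / emeasure N {0<..<t} \<le> emeasure N {0<..<t} / emeasure N {0<..<t}"
      by (rule divide_right_mono_ennreal)
    also have "\<dots> = 1" using N by (rule ennreal_divide_self)
    finally have "epowr (emeasure (power_measure q v g) {0<..<t} / emeasure N {0<..<t}) (1 / q) \<le> epowr 1 (1 / q)"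
      using q by (intro epowr_mono) auto
    then show "epowr (emeasure (power_measure q v g) {0<..<t} / emeasure N {0<..<t}) (1 / q) \<le> 1"
      using epowr_ennreal[of 1 "1 / q"] by simp
  qed
  have "AE x in half_line. 0 < epowr (ennreal \<bar>h x\<bar>) q * ennreal (v x) \<longrightarrow> F x \<noteq> 0"
    using F_nz unfolding M_def power_measure_def by (subst (asm) AE_density) auto
  moreover have "AE x in half_line. 0 < v x"
    using v by (simp add: weight_def)
  ultimately have eq: "AE x in half_line. h x = f x * g x"
  proof eventually_elim
    case (elim x)
    then show ?case
      by (cases "h x = 0") (auto simp: g_def f_def epowr_ennreal ennreal_zero_less_mult_iff)
  qed
  have "(f, g) \<in> factorizations p v h"
    using D G eq L_fin
    by (auto simp: factorizations_def D_space_def G_space_def ennreal_mult_less_top intro: le_less_trans)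
  moreover have "D_norm p v f * G_norm p v g \<le> ennreal s * L_norm p v h"
    using mult_mono[OF D G] by simp
  ultimately show ?thesis by blast
qed

theorem theorem2p1:
  fixes p :: ennreal and v h :: "real \<Rightarrow> real"
  assumes "0 < p" and "weight v" and "h \<in> borel_measurable half_line"
  shows "(h \<in> L_space p v \<longleftrightarrow>
            (\<exists>f g. f \<in> D_space p v \<and> g \<in> G_space p v \<and> (AE x in half_line. h x = f x * g x))) \<and>
         L_norm p v h = (INF (f, g)\<in>factorizations p v h. D_norm p v f * G_norm p v g)"
proof -
  have lower: "L_norm p v h \<le> D_norm p v f * G_norm p v g" if "(f, g) \<in> factorizations p v h" for f g
    using that assms
    by (intro L_norm_le_D_norm_times_G_norm) (auto simp: factorizations_def D_space_def G_space_def)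
  have finite_if: "L_norm p v h < \<infinity>" if "(f, g) \<in> factorizations p v h" for f g
  proof -
    have "D_norm p v f * G_norm p v g < \<infinity>"
      using that by (auto simp: factorizations_def D_space_def G_space_def ennreal_mult_less_top)
    then show ?thesis using lower[OF that] by (rule le_less_trans[rotated])
  qed
  have near: "\<exists>(f, g) \<in> factorizations p v h. D_norm p v f * G_norm p v g \<le> ennreal s * L_norm p v h"
    if "L_norm p v h < \<infinity>" "1 < s" for s
    using exists_near_optimal_factorization[OF assms that] .
  have "h \<in> L_space p v \<longleftrightarrow> factorizations p v h \<noteq> {}"
    using near[of 2] finite_if assms(3) by (force simp: L_space_def)
  then have membership: "h \<in> L_space p v \<longleftrightarrow>
      (\<exists>f g. f \<in> D_space p v \<and> g \<in> G_space p v \<and> (AE x in half_line. h x = f x * g x))"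
    by (auto simp: factorizations_def)
  have "L_norm p v h = (INF (f, g)\<in>factorizations p v h. D_norm p v f * G_norm p v g)"
  proof (rule antisym)
    show "L_norm p v h \<le> (INF (f, g)\<in>factorizations p v h. D_norm p v f * G_norm p v g)"
      using lower by (intro INF_greatest) auto
    show "(INF (f, g)\<in>factorizations p v h. D_norm p v f * G_norm p v g) \<le> L_norm p v h"
    proof (cases "L_norm p v h < \<infinity>")
      case True
      show ?thesis
      proof (rule ennreal_le_if_le_mult_all)
        fix s :: real assume "1 < s"
        from near[OF True this] obtain f g where fg: "(f, g) \<in> factorizations p v h"
          "D_norm p v f * G_norm p v g \<le> ennreal s * L_norm p v h" by blast
        show "(INF (f, g)\<in>factorizations p v h. D_norm p v f * G_norm p v g) \<le> ennreal s * L_norm p v h"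
          by (rule INF_lower2[OF fg(1)]) (use fg(2) in simp)
      qed
    qed (simp add: not_less top_unique)
  qed
  with membership show ?thesis by blast
qed

end
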